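(* Let $c\in(0,1)$ and $\kappa>0$ be fixed. Uniformly for real $x,y$ with $2\le y\le x^{1-c}$ and integers $k$ with $1\le k\le(\log_2 y)/\kappa$, we have $$N_k(x,y)\asymp\frac{x(\log_2 y)^k}{k!\,\log y},$$ where the implied constants depend at most on $c$ and $\kappa$.
   Context: $\log_2 y=\log\log y$. For $n\in\mathbb{N}$ and $y\ge2$, $\nu(n,y):=\sum_{p\mid n,\,p\le y}1$ is the number of distinct prime factors of $n$ not exceeding $y$, and $N_k(x,y):=\#\{n\le x:\nu(n,y)=k\}$ ($n$ positive integers). $f\asymp g$ means $C_1g\le f\le C_2 g$ for positive constants $C_1,C_2$.
   Formalization: The lower bound is claimed only when y ≥ y0(c,κ) or N_k(x,y) ≠ 0, since for bounded y and small κ the range of k can include k with N_k(x,y) = 0 while the main term is positive (e.g. c=1/2, y=4, x=16, k=5, κ=(log log 4)/5); the upper bound holds on the full range. *)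

theory Defs
  imports Complex_Main "HOL-Computational_Algebra.Primes"
begin

definition nu :: "nat \<Rightarrow> real \<Rightarrow> nat" where
  "nu n y = card {p. prime p \<and> p dvd n \<and> real p \<le> y}"

definition N_count :: "nat \<Rightarrow> real \<Rightarrow> real \<Rightarrow> nat" where
  "N_count k x y = card {n::nat. 1 \<le> n \<and> real n \<le> x \<and> nu n y = k}"

(* N_count k x y vanishes if fewer than k primes are at most y, or if the product of the
   first k primes exceeds x; main_term k x y is positive there as soon as y > exp 1. So a lower
   bound of the order of main_term has to exclude such (k, x, y), which for
   k <= ln (ln y) / kappa and y <= x powr (1 - c) occur only for bounded y. *)
definition main_term :: "nat \<Rightarrow> real \<Rightarrow> real \<Rightarrow> real" where
  "main_term k x y = x * ln (ln y) ^ k / (fact k * ln y)"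

end

theory Submission
  imports Defs "HOL-Number_Theory.Prime_Powers" "HOL-Analysis.Harmonic_Numbers"
    "HOL-Real_Asymp.Real_Asymp"
begin

text \<open>
  No sieve is needed. Summing \<open>ln n\<close>, the divisor sum of the von Mangoldt function, over the \<open>n \<le> x\<close>
  with \<open>\<nu>(n, y) = k\<close> and splitting off one prime power compares \<open>N\<^sub>k(x, y) ln x\<close>, via Chebyshev's
  bounds, with \<open>x\<close> times sums of \<open>1 / m\<close> over the \<open>m\<close> with \<open>\<nu>(m, y) \<in> {k - 1, k}\<close>.
  Such an \<open>m\<close> is a product of a \<open>y\<close>-smooth number with \<open>k\<close> (or \<open>k - 1\<close>) prime factors and a
  \<open>y\<close>-rough number. The smooth factors contribute about \<open>(log\<^sub>2 y + O(1))\<^sup>k / k!\<close> by Mertens' theorem,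
  which is of order \<open>(log\<^sub>2 y)\<^sup>k / k!\<close> because \<open>k = O(log\<^sub>2 y)\<close>, and the rough ones \<open>ln x / ln y\<close>.

  For the lower bound \<open>m\<close> has to be at most a small power of \<open>x\<close>. Its small primes are therefore taken
  distinct from an interval \<open>(P\<^sub>0, y\<^sup>\<eta>]\<close>: \<open>P\<^sub>0\<close> large makes coincidences rare, and \<open>\<eta>\<close> small
  makes large products rare, both relative to the same power sum, so the loss is only a constant.
\<close>

section \<open>Chebyshev and Mertens estimates for the von Mangoldt function\<close>

lemma real_nat_div_le: "real (m div n) \<le> real m / real n"
  and real_nat_div_gt: "real m / real n < real (m div n) + 1"
  using floor_divide_of_nat_eq[of m n, where ?'a = real] by linarith+

definition psi :: "nat \<Rightarrow> real" where
  "psi N = (\<Sum>d=1..N. mangoldt d)"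

lemma psi_mono: "M \<le> N \<Longrightarrow> psi M \<le> psi N"
  unfolding psi_def by (intro sum_mono2) (auto simp: mangoldt_nonneg)

text \<open>Each \<open>ln m\<close> is a divisor sum of \<open>mangoldt\<close>, and
  \<open>d\<close> divides exactly \<open>n div d\<close> of the numbers from 1 to \<open>n\<close>.
  Terms with \<open>d > n\<close> vanish; letting the range extend to \<open>N\<close> allows the
  formulas for \<open>2 * n\<close> and \<open>n\<close> to be subtracted termwise.\<close>

lemma ln_fact_eq_sum_mangoldt:
  assumes "n \<le> N"
  shows "ln (fact n) = (\<Sum>d=1..N. mangoldt d * real (n div d))"
  using assms
proof (induction n)
  case (Suc n)
  have div_Suc: "real (Suc n div d) = real (n div d) + (if d dvd Suc n then 1 else 0)"
    if "d \<in> {1..N}" for d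
    using that by (simp add: div_Suc dvd_eq_mod_eq_0)
  have divisor_range: "d \<in> {1..N}" if "d dvd Suc n" for d
    using Suc.prems dvd_imp_le[OF that] dvd_pos_nat[OF _ that] by auto
  have "ln (fact (Suc n)) = ln (real (Suc n)) + ln (fact n)"
    by (simp add: ln_mult)
  also have "ln (real (Suc n)) = (\<Sum>d | d dvd Suc n. mangoldt d)"
    using mangoldt_sum[of "Suc n", where ?'a = real] by simp
  also have "\<dots> = (\<Sum>d=1..N. mangoldt d * (if d dvd Suc n then 1 else 0))"
    using divisor_range by (intro sum.mono_neutral_cong_left) auto
  also have "ln (fact n) = (\<Sum>d=1..N. mangoldt d * real (n div d))"
    using Suc by simp
  also have "(\<Sum>d=1..N. mangoldt d * (if d dvd Suc n then 1 else 0)) + \<dots> =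
             (\<Sum>d=1..N. mangoldt d * real (Suc n div d))"
    unfolding sum.distrib [symmetric]
    by (intro sum.cong refl) (simp add: div_Suc algebra_simps)
  finally show ?case .
qed auto

text \<open>Chebyshev's argument: the floor difference for \<open>2 * n\<close> and twice
  \<open>n\<close> is never negative and is at least 1 when \<open>d > n\<close>, so the increment
  of \<open>psi\<close> is at most the logarithm of the central binomial coefficient.\<close>

lemma psi_double_le: "psi (2 * n) \<le> psi n + 2 * real n"
proof -
  have "psi (2 * n) - psi n = (\<Sum>d=1..2*n. mangoldt d * (if d > n then 1 else 0))"
  proof -
    have "psi (2 * n) = psi n + (\<Sum>d\<in>{n<..2*n}. mangoldt d)"
      unfolding psi_def by (subst sum.union_disjoint [symmetric]) (auto intro!: sum.cong)
    also have "(\<Sum>d\<in>{n<..2*n}. mangoldt d) =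
        (\<Sum>d=1..2*n. mangoldt d * (if d > n then 1 else 0) :: real)"
      by (intro sum.mono_neutral_cong_left) auto
    finally show ?thesis by simp
  qed
  also have "\<dots> \<le> (\<Sum>d=1..2*n. mangoldt d * (real ((2*n) div d) - 2 * real (n div d)))"
  proof (intro sum_mono mult_left_mono mangoldt_nonneg)
    fix d assume d: "d \<in> {1..2*n}"
    have "2 * (n div d) \<le> (2 * n) div d"
      using d by (simp add: less_eq_div_iff_mult_less_eq algebra_simps)
    hence "2 * real (n div d) \<le> real ((2 * n) div d)" by linarith
    moreover have "n div d = 0 \<and> (2 * n) div d \<ge> 1" if "d > n"
      using that d by (auto simp: div_greater_zero_iff Suc_le_eq)
    ultimately show "(if n < d then 1 else 0) \<le> real ((2*n) div d) - 2 * real (n div d)"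
      by auto
  qed
  also have "\<dots> = ln (fact (2 * n)) - 2 * ln (fact n)"
    using ln_fact_eq_sum_mangoldt[of "2*n" "2*n"] ln_fact_eq_sum_mangoldt[of n "2*n"]
    by (simp add: algebra_simps sum_subtractf sum_distrib_left sum.distrib)
  also have "\<dots> = ln (real ((2 * n) choose n))"
    by (simp add: binomial_fact ln_div ln_mult)
  also have "\<dots> \<le> ln (2 ^ (2 * n))"
  proof (subst ln_le_cancel_iff)
    show "real ((2 * n) choose n) \<le> 2 ^ (2 * n)"
      using binomial_le_pow2[of "2*n" n]
      by (metis of_nat_le_iff of_nat_numeral of_nat_power)
  qed auto
  also have "\<dots> = 2 * real n * ln 2"
    by (subst ln_realpow) auto
  also have "\<dots> \<le> 2 * real n * 1"
    using ln_2_less_1 by (intro mult_left_mono) auto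
  finally show ?thesis by simp
qed

lemma psi_le: "psi N \<le> 4 * real N"
proof (induction N rule: less_induct)
  case (less N)
  consider "N = 0" | "N = 1" | n where "n \<ge> 1" "N = 2 * n" | n where "n \<ge> 1" "N = 2 * n + 1"
    by (metis One_nat_def add.left_neutral evenE less_one mult_0_right not_le oddE)
  thus ?case
  proof cases
    case (3 n)
    thus ?thesis using psi_double_le[of n] less.IH[of n] by simp
  next
    case (4 n)
    \<comment> \<open>Rounding an odd \<open>N\<close> up is affordable: doubling gives
      \<open>6 * (n + 1)\<close>, which is at most \<open>4 * (2 * n + 1)\<close> exactly when
      \<open>n >= 1\<close>.\<close>
    have "psi N \<le> psi (2 * (n + 1))" using 4 by (intro psi_mono) auto
    thus ?thesis using 4 psi_double_le[of "n+1"] less.IH[of "n+1"] by simp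
  qed (auto simp: psi_def)
qed

text \<open>\<open>N ^ N / fact N\<close> is a single term of the exponential series at
  \<open>N\<close>.\<close>

lemma ln_fact_ge: "N * ln N - N \<le> ln (fact N :: real)" for N :: nat
proof (cases "N = 0")
  case False
  have "real N ^ N / fact N \<le> exp (real N)"
  proof -
    have "(\<lambda>n. real N ^ n / fact n) sums exp (real N)"
      using exp_converges[of "real N"] by (simp add: field_simps)
    thus ?thesis
      using sum_le_suminf[of "\<lambda>n. real N ^ n / fact n" "{N}"]
      by (simp add: sums_iff)
  qed
  hence "ln (real N ^ N / fact N) \<le> ln (exp (real N))"
    using False by (subst ln_le_cancel_iff) auto
  thus ?thesis
    using False by (simp add: ln_div ln_realpow)
qed auto

lemma ln_fact_le: "ln (fact N :: real) \<le> N * ln N"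
proof (cases "N = 0")
  case False
  have "fact N \<le> real N ^ N"
    using fact_le_power[of N, where ?'a = real] by simp
  hence "ln (fact N :: real) \<le> ln (real N ^ N)"
    using False by (subst ln_le_cancel_iff) auto
  thus ?thesis using False by (simp add: ln_realpow)
qed auto

lemma sum_mangoldt_div_ge:
  assumes "N \<ge> 1"
  shows "ln N - 1 \<le> (\<Sum>d=1..N. mangoldt d / d)"
proof -
  have "N * ln N - N \<le> (\<Sum>d=1..N. mangoldt d * real (N div d))"
    using ln_fact_ge[of N] ln_fact_eq_sum_mangoldt[of N N] by simp
  also have "\<dots> \<le> (\<Sum>d=1..N. mangoldt d * (real N / real d))"
    by (intro sum_mono mult_left_mono mangoldt_nonneg real_nat_div_le)
  also have "\<dots> = N * (\<Sum>d=1..N. mangoldt d / d)"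
    by (simp add: sum_distrib_left mult_ac)
  finally have "N * (ln N - 1) \<le> N * (\<Sum>d=1..N. mangoldt d / d)"
    by (simp add: algebra_simps)
  thus ?thesis using assms by simp
qed

text \<open>Removing the floors from the formula for \<open>ln (fact N)\<close> changes each
  quotient by at most 1, hence the sum by at most \<open>psi N\<close>; Chebyshev's bound supplies
  the 4.\<close>

lemma sum_mangoldt_div_le:
  assumes "N \<ge> 1"
  shows "(\<Sum>d=1..N. mangoldt d / d) \<le> ln N + 4"
proof -
  have "N * (\<Sum>d=1..N. mangoldt d / d) - psi N = (\<Sum>d=1..N. mangoldt d * (real N / d - 1))"
    by (simp add: psi_def sum_distrib_left sum_subtractf algebra_simps)
  also have "\<dots> \<le> (\<Sum>d=1..N. mangoldt d * real (N div d))"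
  proof (intro sum_mono mult_left_mono mangoldt_nonneg)
    show "real N / real d - 1 \<le> real (N div d)" for d
      using real_nat_div_gt[of N d] by simp
  qed
  also have "\<dots> \<le> N * ln N"
    using ln_fact_le[of N] ln_fact_eq_sum_mangoldt[of N N] by simp
  finally have "N * (\<Sum>d=1..N. mangoldt d / d) \<le> N * (ln N + 4)"
    using psi_le[of N] by (simp add: algebra_simps)
  thus ?thesis using assms by simp
qed

text \<open>The two Mertens bounds are compared on the range from \<open>N div 1000\<close> to
  \<open>N\<close>. Since \<open>ln 1000 >= 6\<close> exceeds the combined error
  \<open>1 + 4\<close>, the terms \<open>mangoldt d / d\<close> there add up to at least 1, and each
  \<open>d\<close> exceeds \<open>M\<close>.\<close>

lemma psi_ge:
  assumes "N \<ge> 1000"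
  shows "psi N \<ge> real N / 2000"
proof -
  define M where "M = N div 1000"
  have M: "M \<ge> 1" "1000 * M \<le> N" "N < 1000 * M + 1000"
    using assms by (auto simp: M_def div_greater_zero_iff Suc_le_eq)
  have "exp (6 :: real) = exp 1 ^ 6"
    by (simp flip: exp_of_nat_mult)
  also have "\<dots> \<le> 3 ^ 6"
    by (intro power_mono) (use exp_le in auto)
  also have "\<dots> \<le> (1000 :: real)" by simp
  finally have "6 \<le> ln (1000 :: real)"
    by (subst ln_ge_iff) auto
  also have "\<dots> \<le> ln (real N / real M)"
    using M by (subst ln_le_cancel_iff) (auto simp: field_simps)
  also have "\<dots> = ln N - ln M"
    using M by (subst ln_div) auto
  finally have "1 \<le> (\<Sum>d=1..N. mangoldt d / real d) - (\<Sum>d=1..M. mangoldt d / real d)"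
    using sum_mangoldt_div_ge[of N] sum_mangoldt_div_le[of M] M by simp
  also have "\<dots> = (\<Sum>d\<in>{1..N} - {1..M}. mangoldt d / real d)"
    using M by (subst sum_diff) auto
  also have "\<dots> \<le> (\<Sum>d\<in>{1..N} - {1..M}. mangoldt d / real M)"
    using M by (intro sum_mono divide_left_mono mangoldt_nonneg) auto
  also have "\<dots> \<le> (\<Sum>d\<in>{1..N}. mangoldt d / real M)"
    by (intro sum_mono2) (auto simp: mangoldt_nonneg)
  also have "\<dots> = psi N / real M"
    by (simp add: psi_def sum_divide_distrib)
  finally have "real M \<le> psi N"
    using M by (simp add: field_simps)
  thus ?thesis using M by simp
qed

section \<open>Reciprocals of primes\<close>

definition primes_le :: "real \<Rightarrow> nat set" where
  "primes_le y = {p. prime p \<and> real p \<le> y}"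

lemma finite_primes_le [simp]: "finite (primes_le y)"
  by (rule finite_subset[of _ "{..nat \<lfloor>y\<rfloor>}"]) (auto simp: primes_le_def le_nat_floor)

lemma sum_inverse_consecutive_le:
  fixes A :: "nat set"
  assumes "finite A" and "M \<ge> 1" and "\<And>n. n \<in> A \<Longrightarrow> M < n"
  shows "(\<Sum>n\<in>A. 1 / (real n * (real n - 1))) \<le> 1 / real M"
proof -
  have telescope: "(\<Sum>n\<in>{M<..N}. 1 / (real n * (real n - 1))) = 1 / real M - 1 / real N"
    if "N \<ge> M" for N
    using that
  proof (induction N rule: dec_induct)
    case (step N)
    have "{M<..Suc N} = insert (Suc N) {M<..N}" using step by auto
    hence "(\<Sum>n\<in>{M<..Suc N}. 1 / (real n * (real n - 1))) =
             1 / ((real N + 1) * real N) + (1 / real M - 1 / real N)"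
      using step.IH by (simp add: add.commute)
    also have "\<dots> = 1 / real M - 1 / real (Suc N)"
      using step.hyps \<open>M \<ge> 1\<close> by (simp add: divide_simps) (simp add: algebra_simps)
    finally show ?case .
  qed auto
  obtain N where N: "\<And>n. n \<in> A \<Longrightarrow> n \<le> N"
    using \<open>finite A\<close> by (meson finite_nat_set_iff_bounded_le)
  have "(\<Sum>n\<in>A. 1 / (real n * (real n - 1))) \<le>
        (\<Sum>n\<in>{M<..max M N}. 1 / (real n * (real n - 1)))"
    using assms by (intro sum_mono2) (auto simp: le_max_iff_disj dest: N)
  also have "\<dots> \<le> 1 / real M"
    by (subst telescope) auto
  finally show ?thesis .
qed

lemma sum_inverse_squares_le:
  fixes A :: "nat set"
  assumes "finite A" and "M \<ge> 1" and "\<And>n. n \<in> A \<Longrightarrow> M < n"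
  shows "(\<Sum>n\<in>A. (1 / real n) ^ 2) \<le> 1 / real M"
proof -
  have "(\<Sum>n\<in>A. (1 / real n) ^ 2) \<le> (\<Sum>n\<in>A. 1 / (real n * (real n - 1)))"
  proof (intro sum_mono)
    fix n assume "n \<in> A"
    hence "n > 1" using assms(2) assms(3)[of n] by auto
    thus "(1 / real n) ^ 2 \<le> 1 / (real n * (real n - 1))"
      by (auto simp: field_simps power2_eq_square)
  qed
  also have "\<dots> \<le> 1 / real M" using assms by (rule sum_inverse_consecutive_le)
  finally show ?thesis .
qed

lemma sum_ln_prime_div_le:
  assumes "y \<ge> 1"
  shows "(\<Sum>p\<in>primes_le y. ln p / p) \<le> ln y + 4"
proof -
  define N where "N = nat \<lfloor>y\<rfloor>"
  have N: "N \<ge> 1" "real N \<le> y" using assms by (auto simp: N_def le_nat_floor)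
  have "(\<Sum>p\<in>primes_le y. ln p / p) = (\<Sum>p\<in>primes_le y. mangoldt p / real p)"
    by (intro sum.cong) (auto simp: primes_le_def)
  also have "\<dots> \<le> (\<Sum>d=1..N. mangoldt d / real d)"
    by (intro sum_mono2)
       (auto simp: primes_le_def N_def le_nat_floor mangoldt_nonneg prime_gt_0_nat Suc_le_eq)
  also have "\<dots> \<le> ln N + 4" by (rule sum_mangoldt_div_le) fact
  also have "\<dots> \<le> ln y + 4" using N assms by simp
  finally show ?thesis .
qed

text \<open>Comparison with the integral of \<open>t powr (-1 - s)\<close> from 1 to
  \<open>N\<close>. The subtracted term is the missing tail of that integral and makes the induction
  go through.\<close>

lemma sum_powr_le:
  assumes "s > 0" and "N \<ge> 1"
  shows "(\<Sum>n=1..N. real n powr (-1 - s)) \<le> 1 + 1 / s - real N powr (-s) / s"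
  using assms(2)
proof (induction N rule: dec_induct)
  case (step N)
  define q where "q = real (Suc N) powr (-s)"
  \<comment> \<open>The goal of the step is
    \<open>s * (N + 1) powr (-1 - s) <= N powr (-s) - (N + 1) powr (-s)\<close>; it follows from
    \<open>ln (1 - h) <= - h\<close> and \<open>1 + s * h <= exp (s * h)\<close> with
    \<open>h = 1 / (N + 1)\<close>.\<close>
  have "ln (1 + - 1 / real (Suc N)) \<le> - 1 / real (Suc N)"
    using step by (intro ln_add_one_self_le_self2) (auto simp: field_simps)
  hence "s * ln (1 - 1 / real (Suc N)) \<le> s * (- 1 / real (Suc N))"
    using \<open>s > 0\<close> by (intro mult_left_mono) auto
  hence "exp (s / real (Suc N)) \<le> exp (- s * ln (1 - 1 / real (Suc N)))"
    by simp
  also have "\<dots> = (real N / real (Suc N)) powr (-s)"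
    using step by (simp add: powr_def field_simps)
  also have "\<dots> = real N powr (-s) / q"
    using step by (subst powr_divide) (auto simp: q_def)
  finally have "1 + s / real (Suc N) \<le> real N powr (-s) / q"
    using exp_ge_add_one_self[of "s / real (Suc N)"] by linarith
  hence "q + q * s / real (Suc N) \<le> real N powr (-s)"
    by (simp add: q_def field_simps)
  moreover have "q / real (Suc N) = real (Suc N) powr (-1 - s)"
    by (simp add: q_def powr_diff powr_minus field_simps)
  ultimately have "q + s * real (Suc N) powr (-1 - s) \<le> real N powr (-s)"
    by (metis mult.commute times_divide_eq_right)
  hence "real (Suc N) powr (-1 - s) \<le> real N powr (-s) / s - q / s"
    using \<open>s > 0\<close> by (simp add: field_simps)
  thus ?case using step by (simp add: q_def)
qed auto

lemma prime_dvd_prod_primes_iff: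
  fixes T :: "nat set"
  assumes "finite T" and "\<And>p. p \<in> T \<Longrightarrow> prime p" and "prime q"
  shows "q dvd \<Prod>T \<longleftrightarrow> q \<in> T"
  using assms by (metis dvd_prodI prime_dvd_prod_iff primes_dvd_imp_eq)

lemma inj_on_prod_primes:
  fixes P :: "nat set"
  assumes "finite P" and "\<And>p. p \<in> P \<Longrightarrow> prime p"
  shows "inj_on \<Prod> (Pow P)"
proof (rule inj_onI)
  fix T U assume TU: "T \<in> Pow P" "U \<in> Pow P" "\<Prod>T = \<Prod>U"
  hence "finite T" "finite U" using assms(1) finite_subset by auto
  thus "T = U"
    using prime_dvd_prod_primes_iff[of T] prime_dvd_prod_primes_iff[of U] assms TU
    by (auto simp: subset_iff)
qed

text \<open>Rankin's trick with the exponent \<open>1 + 1 / ln y\<close>: the prime factors \<open>p \<le> y\<close> barely notice the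
  perturbation, while the perturbed harmonic series is bounded by \<open>1 + ln y\<close>.\<close>
lemma sum_inverse_primes_le:
  assumes "y \<ge> 2"
  shows "(\<Sum>p\<in>primes_le y. 1 / p) \<le> ln (ln y) + 12"
proof -
  define s where "s = 1 / ln y"
  define u where "u = (\<lambda>p::nat. real p powr (-1 - s))"
  have "ln 2 \<le> ln y" using assms by simp
  hence lny: "ln y \<ge> 1 / 2" using ln2_ge_two_thirds by linarith
  hence s: "s > 0" by (simp add: s_def)
  have prime: "prime p" "p > 1" if "p \<in> primes_le y" for p
    using that by (auto simp: primes_le_def prime_gt_Suc_0_nat)
  have u_le: "u p \<le> 1 / p" "u p \<ge> 0" "u p \<le> 1" if "p \<in> primes_le y" for p
  proof -
    have "u p \<le> real p powr (-1)"
      unfolding u_def using s prime[OF that] by (intro powr_mono) auto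
    also have "\<dots> = 1 / p" using prime[OF that] by (simp add: powr_minus field_simps)
    finally show "u p \<le> 1 / p" .
    also have "\<dots> \<le> 1" using prime[OF that] by simp
    finally show "u p \<le> 1" .
  qed (auto simp: u_def)

  \<comment> \<open>Expanding the product gives one term for each squarefree product of primes up to
    \<open>y\<close>. Different sets of primes give different integers, so the sum over all integers
    dominates.\<close>
  have "(\<Prod>p\<in>primes_le y. u p + 1) = (\<Sum>T\<in>Pow (primes_le y). \<Prod>p\<in>T. u p)"
    by (subst prod_add) auto
  also have "\<dots> = (\<Sum>T\<in>Pow (primes_le y). real (\<Prod>T) powr (-1 - s))"
    by (intro sum.cong refl) (auto simp: u_def prod_powr_distrib)
  also have "\<dots> = (\<Sum>n\<in>\<Prod> ` Pow (primes_le y). real n powr (-1 - s))"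
    using inj_on_prod_primes[OF finite_primes_le prime(1)] by (simp add: sum.reindex)
  also have "\<dots> \<le> (\<Sum>n=1..\<Prod>(primes_le y). real n powr (-1 - s))"
  proof (rule sum_mono2)
    show "\<Prod> ` Pow (primes_le y) \<subseteq> {1..\<Prod>(primes_le y)}"
    proof safe
      fix T assume T: "T \<subseteq> primes_le y"
      have "\<Prod>(primes_le y) > 0" "\<Prod>T > 0" using T
        by (auto intro!: prod_pos dest!: subsetD prime(2))
      moreover have "\<Prod>T dvd \<Prod>(primes_le y)"
        using T by (intro prod_dvd_prod_subset) auto
      ultimately show "\<Prod>T \<in> {1..\<Prod>(primes_le y)}"
        by (auto intro: dvd_imp_le simp: Suc_le_eq)
    qed
  qed auto
  also have "\<dots> \<le> 1 + 1 / s"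
  proof -
    have "\<Prod>(primes_le y) > 0" by (auto intro!: prod_pos dest!: prime(2))
    hence "(\<Sum>n=1..\<Prod>(primes_le y). real n powr (-1 - s))
             \<le> 1 + 1 / s - real (\<Prod>(primes_le y)) powr (-s) / s"
      by (intro sum_powr_le s) linarith
    also have "\<dots> \<le> 1 + 1 / s" using s by simp
    finally show ?thesis .
  qed
  finally have prod_le: "(\<Prod>p\<in>primes_le y. u p + 1) \<le> 1 + ln y"
    by (simp add: s_def)

  \<comment> \<open>Passing to logarithms with \<open>u - u ^ 2 <= ln (1 + u)\<close> loses only the
    convergent sum of \<open>1 / p ^ 2\<close>, at most 1.\<close>
  have "(\<Sum>p\<in>primes_le y. u p - (1 / real p) ^ 2) \<le> (\<Sum>p\<in>primes_le y. ln (u p + 1))"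
  proof (rule sum_mono)
    fix p assume p: "p \<in> primes_le y"
    have "u p - u p ^ 2 \<le> ln (1 + u p)"
      using u_le[OF p] by (intro ln_one_plus_pos_lower_bound) auto
    moreover have "u p ^ 2 \<le> (1 / real p) ^ 2"
      using u_le[OF p] by (intro power_mono) auto
    ultimately show "u p - (1 / real p) ^ 2 \<le> ln (u p + 1)" by (simp add: add.commute)
  qed
  also have "\<dots> = ln (\<Prod>p\<in>primes_le y. u p + 1)"
  proof (rule ln_prod [symmetric])
    show "u p + 1 \<noteq> 0" if "p \<in> primes_le y" for p using u_le(2)[OF that] by simp
  qed auto
  also have "\<dots> \<le> ln (1 + ln y)"
  proof (rule ln_mono[OF prod_le])
    show "0 < (\<Prod>p\<in>primes_le y. u p + 1)"
      by (intro prod_pos ballI add_nonneg_pos u_le) auto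
  qed
  also have "\<dots> = ln (ln y * (1 + 1 / ln y))"
    using lny by (simp add: distrib_left add.commute)
  also have "\<dots> = ln (ln y) + ln (1 + 1 / ln y)"
    using lny by (intro ln_mult_pos add_pos_pos) auto
  also have "ln (1 + 1 / ln y) \<le> 1 / ln y"
    using lny by (intro ln_add_one_self_le_self) auto
  also have "1 / ln y \<le> 2" using lny by (simp add: field_simps)
  finally have "(\<Sum>p\<in>primes_le y. u p) \<le> ln (ln y) + 2 + (\<Sum>p\<in>primes_le y. (1 / real p) ^ 2)"
    by (simp add: sum_subtractf)
  moreover have "(\<Sum>p\<in>primes_le y. (1 / real p) ^ 2) \<le> 1 / real 1"
    by (intro sum_inverse_squares_le) (auto dest: prime(2))
  \<comment> \<open>Removing the perturbation costs at most \<open>s * ln p / p\<close> per prime.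
    As \<open>s = 1 / ln y\<close>, the total is at most \<open>1 + 4 / ln y\<close>, and
    \<open>ln y >= 1 / 2\<close>.\<close>
  moreover have "(\<Sum>p\<in>primes_le y. 1 / p - u p) \<le> 9"
  proof -
    have "(\<Sum>p\<in>primes_le y. 1 / p - u p) \<le> (\<Sum>p\<in>primes_le y. s * (ln p / p))"
    proof (rule sum_mono)
      fix p assume p: "p \<in> primes_le y"
      have "u p = exp (- s * ln p) / p"
        using prime(2)[OF p] by (simp add: u_def powr_def left_diff_distrib exp_diff exp_minus) (simp add: field_simps)
      moreover have "(1 - s * ln p) / p \<le> exp (- s * ln p) / p"
        using exp_ge_add_one_self[of "- s * ln p"] by (intro divide_right_mono) auto
      ultimately show "1 / p - u p \<le> s * (ln p / p)"
        by (simp add: diff_divide_distrib)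
    qed
    also have "\<dots> \<le> s * (ln y + 4)"
      unfolding sum_distrib_left [symmetric]
      using s assms by (intro mult_left_mono sum_ln_prime_div_le) auto
    also have "\<dots> \<le> 9" using lny by (simp add: s_def field_simps)
    finally show ?thesis .
  qed
  ultimately show ?thesis by (simp add: sum_subtractf)
qed

text \<open>\<open>1 / (p - 1)\<close> is the sum of \<open>1 / p ^ j\<close> over all
  \<open>j >= 1\<close>: the total weight of the powers of \<open>p\<close>, as needed when a full
  prime power is split off.\<close>

definition prime_weight :: "real \<Rightarrow> real" where
  "prime_weight y = (\<Sum>p\<in>primes_le y. 1 / (real p - 1))"

lemma prime_weight_nonneg: "prime_weight y \<ge> 0"
  unfolding prime_weight_def
  by (intro sum_nonneg) (auto simp: primes_le_def dest: prime_gt_0_nat)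

lemma prime_weight_le_sum_inverse: "prime_weight y \<le> (\<Sum>p\<in>primes_le y. 1 / p) + 1"
proof -
  have prime: "p > 1" if "p \<in> primes_le y" for p
    using that by (auto simp: primes_le_def prime_gt_Suc_0_nat)
  have "prime_weight y = (\<Sum>p\<in>primes_le y. 1 / p + 1 / (real p * (real p - 1)))"
    unfolding prime_weight_def
    by (intro sum.cong refl) (auto simp: field_simps dest!: prime)
  also have "\<dots> \<le> (\<Sum>p\<in>primes_le y. 1 / p) + 1 / real 1"
    unfolding sum.distrib
    by (intro add_left_mono sum_inverse_consecutive_le) (auto dest: prime)
  finally show ?thesis by simp
qed

lemma prime_weight_le: "y \<ge> 2 \<Longrightarrow> prime_weight y \<le> ln (ln y) + 13"
  using prime_weight_le_sum_inverse[of y] sum_inverse_primes_le[of y] by simp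

section \<open>Reciprocals of integers with prescribed \<open>\<nu>\<close>\<close>

lemma finite_small_prime_divisors [simp]: "finite {p. prime p \<and> p dvd n \<and> real p \<le> y}"
  by (rule finite_subset[OF _ finite_primes_le[of y]]) (auto simp: primes_le_def)

lemma nu_eq_0_iff: "nu n y = 0 \<longleftrightarrow> (\<forall>p. prime p \<and> p dvd n \<longrightarrow> y < real p)"
  unfolding nu_def by (subst card_0_eq) (auto simp: not_le)

lemma nu_1 [simp]: "nu 1 y = 0"
  by (auto simp: nu_eq_0_iff)

lemma nu_mult_rough:
  assumes "nu d y = 0"
  shows "nu (d * m) y = nu m y"
proof -
  have "{p. prime p \<and> p dvd d * m \<and> real p \<le> y} = {p. prime p \<and> p dvd m \<and> real p \<le> y}"
    using assms by (auto simp: nu_eq_0_iff prime_dvd_mult_iff simp flip: not_le)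
  thus ?thesis by (simp add: nu_def)
qed

lemma prime_dvd_prime_power_mult_iff:
  fixes p q :: nat
  assumes "prime p" and "prime q"
  shows "q dvd p ^ j * m \<longleftrightarrow> q = p \<and> j > 0 \<or> q dvd m"
proof -
  have "q dvd p ^ j \<longleftrightarrow> q = p \<and> j > 0"
    using assms by (cases "j = 0") (auto simp: prime_dvd_power_iff primes_dvd_imp_eq)
  thus ?thesis using assms by (simp add: prime_dvd_mult_iff)
qed

lemma nu_prime_power_mult:
  assumes "prime p" and "real p \<le> y" and "j > 0" and "\<not> p dvd m"
  shows "nu (p ^ j * m) y = Suc (nu m y)"
proof -
  have "{q. prime q \<and> q dvd p ^ j * m \<and> real q \<le> y} =
        insert p {q. prime q \<and> q dvd m \<and> real q \<le> y}"
    using assms by (auto simp: prime_dvd_prime_power_mult_iff)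
  thus ?thesis using assms by (simp add: nu_def)
qed

lemma nu_prime_power_mult_cases:
  assumes "prime p"
  shows "nu (p ^ j * m) y = nu m y \<or> nu (p ^ j * m) y = Suc (nu m y)"
proof -
  define A where "A = {q. prime q \<and> q dvd m \<and> real q \<le> y}"
  define B where "B = {q. prime q \<and> q dvd p ^ j * m \<and> real q \<le> y}"
  have "A \<subseteq> B" "B \<subseteq> insert p A"
    using assms by (auto simp: A_def B_def prime_dvd_prime_power_mult_iff)
  hence "B = A \<or> B = insert p A" by blast
  moreover have "finite A" unfolding A_def by simp
  ultimately have "card B = card A \<or> card B = Suc (card A)"
    by (auto simp: card_insert_if split: if_splits)
  thus ?thesis by (simp add: nu_def A_def B_def)
qed

section \<open>Reciprocal sums graded by the value of \<open>nu\<close>\<close>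

definition recip_sum :: "nat set \<Rightarrow> real \<Rightarrow> nat \<Rightarrow> real" where
  "recip_sum B y k = (\<Sum>m | m \<in> B \<and> nu m y = k. 1 / real m)"

lemma recip_sum_nonneg: "recip_sum B y k \<ge> 0"
  unfolding recip_sum_def by (intro sum_nonneg) auto

lemma sum_inverse_powers_le:
  fixes q :: real
  assumes "q > 1"
  shows "(\<Sum>j=1..J. 1 / q ^ j) \<le> 1 / (q - 1)"
proof -
  have "(\<Sum>j=1..J. 1 / q ^ j) = (1 - 1 / q ^ J) / (q - 1)"
  proof (induction J)
    case (Suc J)
    have "(\<Sum>j=1..Suc J. 1 / q ^ j) = (1 - 1 / q ^ J) / (q - 1) + 1 / q ^ Suc J"
      using Suc by simp
    also have "\<dots> = (1 - 1 / q ^ Suc J) / (q - 1)"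
      using assms by (simp add: divide_simps) (simp add: algebra_simps)
    finally show ?case .
  qed auto
  also have "\<dots> \<le> 1 / (q - 1)"
    using assms by (intro divide_right_mono) auto
  finally show ?thesis .
qed

text \<open>Weight every \<open>m\<close> by its number of prime factors up to \<open>y\<close> and strip off one full prime power.\<close>
lemma recip_sum_Suc_le:
  assumes "finite B" and "0 \<notin> B" and closed: "\<And>m d. m \<in> B \<Longrightarrow> d dvd m \<Longrightarrow> d \<in> B"
  shows "real (Suc k) * recip_sum B y (Suc k) \<le> prime_weight y * recip_sum B y k"
proof -
  define R where "R = (\<lambda>k. {m. m \<in> B \<and> nu m y = k})"
  define D where "D = (\<lambda>n. {p. prime p \<and> p dvd n \<and> real p \<le> y})"
  have fin [simp]: "finite (R k)" "finite (D n)" for k n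
    using assms(1) by (auto simp: R_def D_def)
  \<comment> \<open>A bound for the elements of \<open>B\<close> also bounds the exponents that
    occur, since \<open>j < p ^ j <= m\<close>.\<close>
  obtain J where J: "\<And>m. m \<in> B \<Longrightarrow> m \<le> J"
    using \<open>finite B\<close> by (meson finite_nat_set_iff_bounded_le)
  have "real (Suc k) * recip_sum B y (Suc k) = (\<Sum>m\<in>R (Suc k). \<Sum>p\<in>D m. 1 / real m)"
    unfolding recip_sum_def sum_distrib_left
    by (intro sum.cong) (auto simp: R_def D_def nu_def simp del: of_nat_Suc)
  also have "\<dots> = (\<Sum>(m, p)\<in>Sigma (R (Suc k)) D. 1 / real m)"
    by (subst sum.Sigma) auto
  \<comment> \<open>The pair \<open>(m, p)\<close> is recovered from \<open>(p, j, m')\<close>,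
    where \<open>j\<close> is the exact multiplicity of \<open>p\<close> in \<open>m\<close> and
    \<open>m'\<close> is the cofactor. It lies in \<open>B\<close> by divisor closure and has lost
    precisely one small prime.\<close>
  also have "\<dots> \<le> (\<Sum>(p, j, m)\<in>primes_le y \<times> {1..J} \<times> R k. 1 / real p ^ j * (1 / real m))"
  proof (rule sum_le_included[where i = "\<lambda>(p, j, m). (p ^ j * m, p)"])
    show "\<forall>a\<in>Sigma (R (Suc k)) D. \<exists>b\<in>primes_le y \<times> {1..J} \<times> R k.
            (case b of (p, j, m) \<Rightarrow> (p ^ j * m, p)) = a \<and>
            (case a of (m, p) \<Rightarrow> 1 / real m) \<le> (case b of (p, j, m) \<Rightarrow> 1 / real p ^ j * (1 / real m))"
    proof safe
      fix m p assume m: "m \<in> R (Suc k)" and p: "p \<in> D m"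
      have mB: "m \<in> B" "nu m y = Suc k" "m \<noteq> 0" and pp: "prime p" "p dvd m" "real p \<le> y"
        using m p \<open>0 \<notin> B\<close> by (auto simp: R_def D_def intro!: Nat.gr0I)
      define j where "j = multiplicity p m"
      obtain m' where m': "m = p ^ j * m'" "\<not> p dvd m'"
        using multiplicity_decompose'[of m p] mB pp unfolding j_def
        by (metis not_prime_unit)
      have "j > 0" using pp mB by (simp add: j_def prime_multiplicity_gt_zero_iff)
      have "j < p ^ j" using pp prime_gt_Suc_0_nat[of p] by (intro power_gt_expt) auto
      also have "\<dots> \<le> m" using m' mB by (intro dvd_imp_le) auto
      also have "\<dots> \<le> J" using J mB by simp
      finally have "j \<in> {1..J}" using \<open>j > 0\<close> by auto
      moreover have "m' \<in> R k"
        using closed[OF mB(1), of m'] nu_prime_power_mult[OF pp(1,3) \<open>j > 0\<close> m'(2)] mB m'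
        by (auto simp: R_def)
      ultimately show "\<exists>b\<in>primes_le y \<times> {1..J} \<times> R k.
            (case b of (p, j, m) \<Rightarrow> (p ^ j * m, p)) = (m, p) \<and>
            1 / real m \<le> (case b of (p, j, m) \<Rightarrow> 1 / real p ^ j * (1 / real m))"
        using pp m'(1) by (intro bexI[of _ "(p, j, m')"]) (auto simp: primes_le_def)
    qed
  qed auto
  also have "\<dots> = (\<Sum>p\<in>primes_le y. \<Sum>j=1..J. 1 / real p ^ j) * recip_sum B y k"
    unfolding recip_sum_def R_def sum_distrib_right
    unfolding sum_distrib_left sum.cartesian_product by (simp add: case_prod_unfold)
  also have "\<dots> \<le> prime_weight y * recip_sum B y k"
    unfolding prime_weight_def
    by (intro mult_right_mono sum_mono sum_inverse_powers_le recip_sum_nonneg)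
       (auto simp: primes_le_def prime_gt_Suc_0_nat)
  finally show ?thesis .
qed

lemma recip_sum_le:
  assumes "finite B" and "0 \<notin> B" and "\<And>m d. m \<in> B \<Longrightarrow> d dvd m \<Longrightarrow> d \<in> B"
  shows "recip_sum B y k \<le> prime_weight y ^ k / fact k * recip_sum B y 0"
proof (induction k)
  case (Suc k)
  have "real (Suc k) * recip_sum B y (Suc k) \<le> prime_weight y * recip_sum B y k"
    using assms by (rule recip_sum_Suc_le)
  also have "\<dots> \<le> prime_weight y * (prime_weight y ^ k / fact k * recip_sum B y 0)"
    by (intro mult_left_mono Suc prime_weight_nonneg)
  finally have "recip_sum B y (Suc k) * real (Suc k) \<le>
      prime_weight y ^ Suc k / fact k * recip_sum B y 0"
    by (simp add: mult_ac)
  hence "recip_sum B y (Suc k) \<le> prime_weight y ^ Suc k / fact k * recip_sum B y 0 / real (Suc k)"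
    by (subst pos_le_divide_eq) auto
  thus ?case by (simp add: mult_ac)
qed auto

section \<open>Smooth numbers and the lower bound for \<open>prime_weight\<close>\<close>

definition smooth_upto :: "real \<Rightarrow> nat \<Rightarrow> nat set" where
  "smooth_upto y N = {a \<in> {1..N}. \<forall>p. prime p \<and> p dvd a \<longrightarrow> real p \<le> y}"

lemma finite_smooth_upto [simp]: "finite (smooth_upto y N)"
  by (simp add: smooth_upto_def)

text \<open>Grouped by \<open>nu\<close>, the smooth numbers contribute at most the terms of the
  exponential series at \<open>prime_weight y\<close>, because 1 is the only smooth number with
  \<open>nu = 0\<close>. The cutoff \<open>N\<close> keeps the set finite and closed under
  divisors.\<close>

lemma sum_smooth_le: "(\<Sum>a\<in>smooth_upto y N. 1 / real a) \<le> exp (prime_weight y)"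
proof -
  define B where "B = smooth_upto y N"
  have [simp]: "finite B" by (simp add: B_def)
  have closed: "d \<in> B" if "m \<in> B" "d dvd m" for m d
    using that dvd_imp_le[of d m] dvd_pos_nat[of m d]
    by (auto simp: B_def smooth_upto_def dest: dvd_trans[OF _ that(2)])
  have 0: "0 \<notin> B" by (auto simp: B_def smooth_upto_def)
  have "recip_sum B y 0 \<le> (\<Sum>m\<in>{1::nat}. 1 / real m)"
    unfolding recip_sum_def
  proof (rule sum_mono2)
    show "{m. m \<in> B \<and> nu m y = 0} \<subseteq> {1}"
    proof safe
      fix m assume m: "m \<in> B" "nu m y = 0"
      show "m = 1"
      proof (rule ccontr)
        assume "m \<noteq> 1"
        then obtain p where "prime p" "p dvd m" using prime_factor_nat by blast
        with m show False by (auto simp: B_def smooth_upto_def nu_eq_0_iff simp flip: not_le)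
      qed
    qed
  qed auto
  hence recip_0: "recip_sum B y 0 \<le> 1" by simp
  have sums: "(\<lambda>n. prime_weight y ^ n / fact n) sums exp (prime_weight y)"
    using exp_converges[of "prime_weight y"] by (simp add: divide_inverse mult.commute)

  have "(\<Sum>a\<in>B. 1 / real a) = (\<Sum>k\<in>(\<lambda>a. nu a y) ` B. recip_sum B y k)"
    unfolding recip_sum_def using sum.group[of B "(\<lambda>a. nu a y) ` B" "\<lambda>a. nu a y" "\<lambda>a. 1 / real a"]
    by simp
  also have "\<dots> \<le> (\<Sum>k\<in>(\<lambda>a. nu a y) ` B. prime_weight y ^ k / fact k)"
  proof (rule sum_mono)
    fix k
    have "recip_sum B y k \<le> prime_weight y ^ k / fact k * recip_sum B y 0"
      using closed 0 by (intro recip_sum_le) auto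
    also have "\<dots> \<le> prime_weight y ^ k / fact k * 1"
      using recip_0 prime_weight_nonneg by (intro mult_left_mono) auto
    finally show "recip_sum B y k \<le> prime_weight y ^ k / fact k" by simp
  qed
  also have "\<dots> \<le> (\<Sum>k. prime_weight y ^ k / fact k)"
    using sums prime_weight_nonneg by (intro sum_le_suminf) (auto simp: sums_iff)
  also have "\<dots> = exp (prime_weight y)" using sums by (simp add: sums_iff)
  finally show ?thesis by (simp add: B_def)
qed

lemma sum_inverse_ge_ln: "ln (real N + 1) \<le> (\<Sum>n=1..N. 1 / real n)"
  using ln_le_harm[of N] by (simp add: harm_def inverse_eq_divide)

lemma sum_inverse_le_ln:
  assumes "N \<ge> 1"
  shows "(\<Sum>n=1..N. 1 / real n) \<le> 1 + ln (real N)"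
  using euler_mascheroni_sequence_decreasing[of 1 N] assms by (simp add: harm_def inverse_eq_divide)

lemma smooth_upto_floor: "smooth_upto y (nat \<lfloor>y\<rfloor>) = {1..nat \<lfloor>y\<rfloor>}"
proof -
  have "real p \<le> y" if "p dvd a" "a \<ge> 1" "a \<le> nat \<lfloor>y\<rfloor>" for p a
  proof -
    have "p \<le> nat \<lfloor>y\<rfloor>" using dvd_imp_le[OF that(1)] that by simp
    moreover have "nat \<lfloor>y\<rfloor> \<ge> 1" using that by simp
    ultimately show ?thesis by linarith
  qed
  thus ?thesis by (auto simp: smooth_upto_def)
qed

lemma ln_le_sum_inverse_floor:
  assumes "y \<ge> 1"
  shows "ln y \<le> (\<Sum>a=1..nat \<lfloor>y\<rfloor>. 1 / real a)"
proof -
  have "y \<le> real (nat \<lfloor>y\<rfloor>) + 1" using assms by linarith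
  hence "ln y \<le> ln (real (nat \<lfloor>y\<rfloor>) + 1)"
    using assms by (intro ln_mono) auto
  also have "\<dots> \<le> (\<Sum>a=1..nat \<lfloor>y\<rfloor>. 1 / real a)" by (rule sum_inverse_ge_ln)
  finally show ?thesis .
qed

text \<open>Every positive integer up to \<open>y\<close> is smooth, so the harmonic sum up to
  \<open>y\<close>, at least \<open>ln y\<close>, is bounded by
  \<open>exp (prime_weight y)\<close>.\<close>

lemma prime_weight_ge:
  assumes "y > 1"
  shows "ln (ln y) \<le> prime_weight y"
proof -
  have "ln y \<le> exp (prime_weight y)"
    using ln_le_sum_inverse_floor[of y] sum_smooth_le[of y "nat \<lfloor>y\<rfloor>"] assms
    by (simp add: smooth_upto_floor)
  hence "ln (ln y) \<le> ln (exp (prime_weight y))"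
    using assms by (intro ln_mono) auto
  thus ?thesis by simp
qed

section \<open>The upper bound\<close>

lemma coprime_smooth_rough:
  assumes "a \<ge> 1" and "real a \<le> y" and "nu b y = 0"
  shows "coprime a b"
proof (rule ccontr)
  assume "\<not> coprime a b"
  then obtain p where p: "prime p" "p dvd a" "p dvd b"
    using prime_factor_nat[of "gcd a b"] by (auto simp: coprime_iff_gcd_eq_1)
  hence "p \<le> a" using assms(1) by (intro dvd_imp_le) auto
  thus False using p assms by (auto simp: nu_eq_0_iff)
qed

text \<open>Multiplying the rough \<open>b <= X\<close> by all \<open>a <= y\<close> gives distinct
  integers up to \<open>Y * X\<close>: coprimality forces equal products to have equal factors. The
  harmonic sum over \<open>a\<close> supplies the factor \<open>ln y\<close>.\<close>

lemma rough_sum_le: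
  assumes "y \<ge> 2" and "nat \<lfloor>y\<rfloor> \<le> X"
  shows "ln y * recip_sum {1..X} y 0 \<le> 4 * ln (real X)"
proof -
  define Y where "Y = nat \<lfloor>y\<rfloor>"
  define R where "R = {b. b \<in> {1..X} \<and> nu b y = 0}"
  have Y: "real Y \<le> y" "Y \<ge> 2" "Y \<le> X"
    using assms by (auto simp: Y_def le_nat_floor)
  have finR [simp]: "finite R" by (simp add: R_def)
  have inj: "inj_on (\<lambda>(a, b). a * b) ({1..Y} \<times> R)"
  proof (rule inj_onI, safe)
    fix a b a' b' assume H: "a \<in> {1..Y}" "a' \<in> {1..Y}" "b \<in> R" "b' \<in> R" "a * b = a' * b'"
    have "real a \<le> y" "real a' \<le> y" using H Y by auto
    hence cop: "coprime a b'" "coprime a' b"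
      using H by (auto simp: R_def intro: coprime_smooth_rough)
    have "a dvd a' * b'" "a' dvd a * b" using H by (metis dvd_triv_left)+
    hence "a dvd a'" "a' dvd a"
      using cop by (simp_all add: coprime_dvd_mult_left_iff)
    thus "a = a'" by (rule dvd_antisym)
    thus "b = b'" using H by simp
  qed
  have "ln y * recip_sum {1..X} y 0 \<le> (\<Sum>a=1..Y. 1 / real a) * (\<Sum>b\<in>R. 1 / real b)"
    unfolding recip_sum_def R_def Y_def
    by (intro mult_mono ln_le_sum_inverse_floor sum_nonneg) (use assms in auto)
  also have "\<dots> = (\<Sum>(a, b)\<in>{1..Y} \<times> R. 1 / real (a * b))"
    by (simp add: sum_product sum.cartesian_product)
  also have "\<dots> = (\<Sum>n\<in>(\<lambda>(a, b). a * b) ` ({1..Y} \<times> R). 1 / real n)"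
    by (subst sum.reindex[OF inj]) (auto intro!: sum.cong)
  also have "\<dots> \<le> (\<Sum>n=1..Y * X. 1 / real n)"
    by (intro sum_mono2) (auto simp: R_def intro: mult_le_mono)
  also have "\<dots> \<le> 1 + ln (real (Y * X))"
    using Y by (intro sum_inverse_le_ln) auto
  also have "\<dots> = 1 + ln (real Y) + ln (real X)"
    using Y by (simp add: ln_mult)
  also have "\<dots> \<le> 4 * ln (real X)"
  proof -
    have "ln 2 \<le> ln (real X)" "ln (real Y) \<le> ln (real X)" using Y by auto
    thus ?thesis using ln2_ge_two_thirds by linarith
  qed
  finally show ?thesis .
qed

lemma ex_smooth_rough_decomposition:
  fixes n :: nat
  assumes "n \<ge> 1"
  shows "\<exists>a b. n = a * b \<and> (\<forall>p. prime p \<and> p dvd a \<longrightarrow> real p \<le> y) \<and> nu b y = 0"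
  using assms
proof (induction n rule: less_induct)
  case (less n)
  show ?case
  proof (cases "n = 1")
    case True
    thus ?thesis using nu_1[of y] by (intro exI[of _ 1]) auto
  next
    case False
    then obtain p where p: "prime p" "p dvd n" using prime_factor_nat by blast
    then obtain m where m: "n = p * m" by auto
    have "m < n" "m \<ge> 1" using less.prems m p prime_gt_Suc_0_nat[of p] by (auto intro!: Nat.gr0I simp: Suc_le_eq)
    with less.IH obtain a b where ab: "m = a * b" "\<forall>p. prime p \<and> p dvd a \<longrightarrow> real p \<le> y" "nu b y = 0"
      by blast
    show ?thesis
    proof (cases "real p \<le> y")
      case True
      thus ?thesis using ab m p
        by (intro exI[of _ "p * a"] exI[of _ b])
           (auto simp: prime_dvd_prime_power_mult_iff[of p _ 1, simplified])
    next
      case False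
      thus ?thesis using ab m p
        by (intro exI[of _ a] exI[of _ "p * b"])
           (auto simp: prime_dvd_prime_power_mult_iff[of p _ 1, simplified] nu_eq_0_iff)
    qed
  qed
qed

text \<open>Each \<open>n <= X\<close> is a smooth number times a rough one, so the harmonic sum up
  to \<open>X\<close> is at most the product of the two reciprocal sums.\<close>

lemma rough_sum_ge: "ln (real X + 1) \<le> exp (prime_weight y) * recip_sum {1..X} y 0"
proof -
  define R where "R = {b. b \<in> {1..X} \<and> nu b y = 0}"
  have "ln (real X + 1) \<le> (\<Sum>n=1..X. 1 / real n)" by (rule sum_inverse_ge_ln)
  also have "\<dots> \<le> (\<Sum>(a, b)\<in>smooth_upto y X \<times> R. 1 / real (a * b))"
  proof (rule sum_le_included[where i = "\<lambda>(a, b). a * b"])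
    show "\<forall>n\<in>{1..X}. \<exists>ab\<in>smooth_upto y X \<times> R. (case ab of (a, b) \<Rightarrow> a * b) = n \<and>
            1 / real n \<le> (case ab of (a, b) \<Rightarrow> 1 / real (a * b))"
    proof
      fix n assume n: "n \<in> {1..X}"
      then obtain a b where ab: "n = a * b" "\<forall>p. prime p \<and> p dvd a \<longrightarrow> real p \<le> y" "nu b y = 0"
        using ex_smooth_rough_decomposition[of n y] by auto
      have "a \<ge> 1" "b \<ge> 1" using n ab(1) by (auto intro!: Nat.gr0I simp: Suc_le_eq)
      moreover from this have "a \<le> n" "b \<le> n" using ab(1) by simp_all
      hence "a \<le> X" "b \<le> X" using n by simp_all
      ultimately have "(a, b) \<in> smooth_upto y X \<times> R" using ab n by (auto simp: smooth_upto_def R_def)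
      thus "\<exists>ab\<in>smooth_upto y X \<times> R. (case ab of (a, b) \<Rightarrow> a * b) = n \<and>
            1 / real n \<le> (case ab of (a, b) \<Rightarrow> 1 / real (a * b))"
        using ab(1) by (intro bexI[of _ "(a, b)"]) auto
    qed
  qed (auto simp: R_def)
  also have "\<dots> = (\<Sum>a\<in>smooth_upto y X. 1 / real a) * recip_sum {1..X} y 0"
    by (simp add: sum_product sum.cartesian_product recip_sum_def R_def)
  also have "\<dots> \<le> exp (prime_weight y) * recip_sum {1..X} y 0"
    by (intro mult_right_mono sum_smooth_le recip_sum_nonneg)
  finally show ?thesis .
qed

text \<open>Write \<open>ln n\<close> as a sum over prime powers \<open>d\<close> dividing
  \<open>n\<close>. The cofactor \<open>m\<close> has \<open>k\<close> or \<open>k - 1\<close> small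
  primes, and for fixed \<open>m\<close> the admissible \<open>d\<close> contribute at most
  \<open>psi (X div m)\<close>, hence at most \<open>4 * X / m\<close>.\<close>

lemma card_mult_ln_le:
  assumes "X \<ge> 1"
  shows "real (card {n \<in> {1..X}. nu n y = k}) * ln (real X) \<le>
           5 * real X * (recip_sum {1..X} y k + recip_sum {1..X} y (k - 1))"
proof -
  define R where "R = (\<lambda>k. {m. m \<in> {1..X} \<and> nu m y = k})"
  define M where "M = R k \<union> R (k - 1)"
  have fin [simp]: "finite (R k)" "finite M" for k by (auto simp: R_def M_def)
  have "(\<Sum>n\<in>R k. ln (real n)) = (\<Sum>n\<in>R k. \<Sum>d | d dvd n \<and> primepow d. mangoldt d)"
  proof (rule sum.cong)
    fix n assume "n \<in> R k"
    hence n: "n > 0" by (auto simp: R_def)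
    hence "ln (real n) = (\<Sum>d | d dvd n. mangoldt d)"
      using mangoldt_sum[of n, where ?'a = real] by simp
    also have "\<dots> = (\<Sum>d | d dvd n \<and> primepow d. mangoldt d)"
      using n by (intro sum.mono_neutral_right) (auto simp: mangoldt_def)
    finally show "ln (real n) = (\<Sum>d | d dvd n \<and> primepow d. mangoldt d)" .
  qed auto
  also have "\<dots> = (\<Sum>(n, d)\<in>Sigma (R k) (\<lambda>n. {d. d dvd n \<and> primepow d}). mangoldt d)"
    by (subst sum.Sigma) (auto simp: R_def)
  also have "\<dots> \<le> (\<Sum>(m, d)\<in>Sigma M (\<lambda>m. {1..X div m}). mangoldt d)"
  proof (rule sum_le_included[where i = "\<lambda>(m, d). (d * m, d)"])
    show "\<forall>a\<in>Sigma (R k) (\<lambda>n. {d. d dvd n \<and> primepow d}). \<exists>b\<in>Sigma M (\<lambda>m. {1..X div m}).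
            (case b of (m, d) \<Rightarrow> (d * m, d)) = a \<and>
            ((case a of (n, d) \<Rightarrow> mangoldt d) :: real) \<le> (case b of (m, d) \<Rightarrow> mangoldt d)"
    proof safe
      fix n d assume n: "n \<in> R k" and d: "d dvd n" "primepow d"
      from d obtain m where m: "n = d * m" by auto
      from d obtain p j where pj: "prime p" "d = p ^ j" by (auto simp: primepow_def)
      have n': "n \<ge> 1" "n \<le> X" "nu n y = k" using n by (auto simp: R_def)
      have pos: "m \<ge> 1" "d \<ge> 1" using n' m by (auto intro!: Nat.gr0I simp: Suc_le_eq)
      have "m \<le> n" using m pos by simp
      hence "m \<le> X" using n' by simp
      hence "m \<in> M"
        using nu_prime_power_mult_cases[OF pj(1), of j m y] pos n' m pj by (auto simp: M_def R_def)
      moreover have "d \<le> X div m"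
        using pos n' m by (simp add: less_eq_div_iff_mult_less_eq)
      ultimately show "\<exists>b\<in>Sigma M (\<lambda>m. {1..X div m}). (case b of (m, d) \<Rightarrow> (d * m, d)) = (n, d) \<and>
            (mangoldt d :: real) \<le> (case b of (m, d) \<Rightarrow> mangoldt d)"
        using m pos by (intro bexI[of _ "(m, d)"]) auto
    qed
  qed (auto simp: R_def mangoldt_nonneg)
  also have "\<dots> = (\<Sum>m\<in>M. psi (X div m))"
    unfolding psi_def by (subst sum.Sigma) auto
  also have "\<dots> \<le> (\<Sum>m\<in>M. 4 * real X * (1 / real m))"
  proof (rule sum_mono)
    fix m
    have "psi (X div m) \<le> 4 * real (X div m)" by (rule psi_le)
    also have "\<dots> \<le> 4 * (real X / real m)"
      by (intro mult_left_mono real_nat_div_le) auto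
    finally show "psi (X div m) \<le> 4 * real X * (1 / real m)" by simp
  qed
  also have "\<dots> = 4 * real X * (\<Sum>m\<in>M. 1 / real m)"
    by (simp add: sum_distrib_left)
  also have "(\<Sum>m\<in>M. 1 / real m) \<le> recip_sum {1..X} y k + recip_sum {1..X} y (k - 1)"
    unfolding M_def recip_sum_def R_def [symmetric]
    by (subst sum_Un) (auto intro!: sum_nonneg simp: R_def)
  finally have sum_ln: "(\<Sum>n\<in>R k. ln (real n)) \<le>
      4 * real X * (recip_sum {1..X} y k + recip_sum {1..X} y (k - 1))"
    by (simp add: mult_left_mono)
  \<comment> \<open>\<open>ln n\<close> is completed to \<open>ln X\<close>; the deficit
    \<open>ln (X / n)\<close> is at most \<open>X / n\<close>, which raises the constant from 4 to
    5.\<close>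
  have "(\<Sum>n\<in>R k. ln (real X / real n)) \<le> (\<Sum>n\<in>R k. real X * (1 / real n))"
  proof (rule sum_mono)
    fix n assume "n \<in> R k"
    hence "real X / real n > 0" using assms by (auto simp: R_def)
    thus "ln (real X / real n) \<le> real X * (1 / real n)"
      using ln_le_minus_one[of "real X / real n"] by simp
  qed
  also have "\<dots> = real X * recip_sum {1..X} y k"
    by (simp add: recip_sum_def R_def sum_distrib_left)
  also have "\<dots> \<le> real X * (recip_sum {1..X} y k + recip_sum {1..X} y (k - 1))"
    by (intro mult_left_mono) (auto simp: recip_sum_nonneg)
  finally have "(\<Sum>n\<in>R k. ln (real n)) + (\<Sum>n\<in>R k. ln (real X / real n)) \<le>
      5 * real X * (recip_sum {1..X} y k + recip_sum {1..X} y (k - 1))"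
    using sum_ln by (simp add: algebra_simps)
  also have "(\<Sum>n\<in>R k. ln (real n)) + (\<Sum>n\<in>R k. ln (real X / real n)) = (\<Sum>n\<in>R k. ln (real X))"
    unfolding sum.distrib [symmetric]
    using assms by (intro sum.cong) (auto simp: R_def ln_div)
  finally show ?thesis by (simp add: R_def)
qed

lemma N_count_eq: "x \<ge> 0 \<Longrightarrow> N_count k x y = card {n \<in> {1..nat \<lfloor>x\<rfloor>}. nu n y = k}"
  unfolding N_count_def by (intro arg_cong[of _ _ card]) (auto simp: le_nat_iff le_floor_iff)

text \<open>\<open>(1 + C / u) ^ k\<close> is at most \<open>exp (C * k / u)\<close>. Thus an
  additive error in Mertens' theorem costs only a constant factor as long as \<open>k\<close> is of
  order at most \<open>u\<close>.\<close>

lemma power_add_le_exp: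
  fixes u C t :: real
  assumes "u > 0" and "C \<ge> 0" and "real k \<le> u * t"
  shows "(u + C) ^ k \<le> exp (C * t) * u ^ k"
proof -
  have "(u + C) ^ k = (1 + C / u) ^ k * u ^ k"
    using assms by (simp flip: power_mult_distrib add: field_simps)
  also have "(1 + C / u) ^ k \<le> exp (C / u) ^ k"
    using assms by (intro power_mono exp_ge_add_one_self) auto
  also have "exp (C / u) ^ k = exp (C * (real k / u))"
    by (simp add: exp_of_nat_mult [symmetric] field_simps)
  also have "\<dots> \<le> exp (C * t)"
    using assms by (auto intro!: mult_left_mono simp: field_simps)
  finally show ?thesis using assms by simp
qed

lemma N_count_upper_bound:
  assumes "\<kappa> > 0" and "y \<ge> 2" and "y \<le> x" and "k \<ge> 1" and "real k \<le> ln (ln y) / \<kappa>"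
  shows "real (N_count k x y) \<le> 20 * exp (13 / \<kappa>) * (1 + 1 / \<kappa>) * main_term k x y"
proof -
  define X where "X = nat \<lfloor>x\<rfloor>"
  define L where "L = ln (ln y)"
  define F where "F = prime_weight y"
  define E where "E = exp (13 / \<kappa>) * L ^ k / fact k"
  have "real k > 0" using assms by simp
  hence "L / \<kappa> > 0" using assms unfolding L_def by linarith
  hence L: "L > 0" using assms by (simp add: zero_less_divide_iff)
  have kL: "real k \<le> L * (1 / \<kappa>)" using assms by (simp add: L_def)
  have lny: "ln y > 0" using assms by simp
  obtain j where j: "k = Suc j" using assms by (cases k) auto
  have F: "0 \<le> F" "F \<le> L + 13"
    using assms prime_weight_nonneg[of y] prime_weight_le[of y] by (auto simp: F_def L_def)
  have Xx: "real X \<le> x" "X \<ge> 2" using assms by (auto simp: X_def le_nat_floor)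
  have YX: "nat \<lfloor>y\<rfloor> \<le> X" using assms by (auto simp: X_def intro!: nat_mono floor_mono)
  have S0: "recip_sum {1..X} y 0 \<le> 4 * ln (real X) / ln y"
    using rough_sum_le[of y X] assms lny YX by (simp add: field_simps)
  have Fk: "F ^ k / fact k \<le> E"
  proof -
    have "F ^ k \<le> (L + 13) ^ k" using F by (intro power_mono) auto
    also have "\<dots> \<le> exp (13 * (1 / \<kappa>)) * L ^ k" using L kL by (intro power_add_le_exp) auto
    finally show ?thesis by (simp add: E_def divide_right_mono)
  qed
  \<comment> \<open>The term for \<open>k - 1\<close> is raised to the one for \<open>k\<close> by
    the factor \<open>L / (\<kappa> * k)\<close>, which is at least 1 by the assumed bound on
    \<open>k\<close>.\<close>
  have Fj: "F ^ j / fact j \<le> E / \<kappa>"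
  proof -
    have "F ^ j \<le> (L + 13) ^ j" using F by (intro power_mono) auto
    also have "\<dots> \<le> exp (13 * (1 / \<kappa>)) * L ^ j" using L kL j by (intro power_add_le_exp) auto
    finally have "F ^ j / fact j \<le> exp (13 / \<kappa>) * L ^ j / fact j * 1"
      by (simp add: divide_right_mono)
    also have "\<dots> \<le> exp (13 / \<kappa>) * L ^ j / fact j * (L * (1 / \<kappa>) / real k)"
    proof (intro mult_left_mono)
      show "1 \<le> L * (1 / \<kappa>) / real k"
        using kL \<open>real k > 0\<close> by (subst pos_le_divide_eq) auto
    qed (use L in auto)
    also have "\<dots> = E / \<kappa>"
      using j by (simp add: E_def field_simps)
    finally show ?thesis .
  qed
  have rs: "recip_sum {1..X} y i \<le> F ^ i / fact i * recip_sum {1..X} y 0" for i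
    unfolding F_def using dvd_imp_le
    by (intro recip_sum_le) (auto intro: Nat.gr0I simp: Suc_le_eq intro: order.trans)
  have "real (N_count k x y) * ln (real X) \<le>
          5 * real X * (recip_sum {1..X} y k + recip_sum {1..X} y j)"
    using card_mult_ln_le[of X y k] assms Xx N_count_eq[of x k y] j by (simp add: X_def)
  also have "\<dots> \<le> 5 * real X * ((E + E / \<kappa>) * (4 * ln (real X) / ln y))"
  proof (intro mult_left_mono)
    have "recip_sum {1..X} y k + recip_sum {1..X} y j \<le>
            (F ^ k / fact k + F ^ j / fact j) * recip_sum {1..X} y 0"
      using rs[of k] rs[of j] by (simp add: algebra_simps)
    also have "\<dots> \<le> (E + E / \<kappa>) * (4 * ln (real X) / ln y)"
      using Fk Fj S0 F assms L by (intro mult_mono add_mono recip_sum_nonneg) (auto simp: E_def)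
    finally show "recip_sum {1..X} y k + recip_sum {1..X} y j \<le> (E + E / \<kappa>) * (4 * ln (real X) / ln y)" .
  qed auto
  also have "\<dots> = (20 * real X * (E + E / \<kappa>) / ln y) * ln (real X)"
    by simp
  \<comment> \<open>The factor \<open>ln X\<close> gained from the rough numbers cancels the one on
    the left.\<close>
  finally have "real (N_count k x y) \<le> 20 * real X * (E + E / \<kappa>) / ln y"
    by (rule mult_right_le_imp_le) (use Xx in simp)
  also have "\<dots> \<le> 20 * x * (E + E / \<kappa>) / ln y"
    using Xx lny L assms by (intro divide_right_mono mult_right_mono mult_left_mono) (auto simp: E_def)
  also have "\<dots> = 20 * exp (13 / \<kappa>) * (1 + 1 / \<kappa>) * main_term k x y"
    using lny assms by (simp add: E_def main_term_def L_def field_simps)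
  finally show ?thesis .
qed

section \<open>Elementary symmetric sums\<close>

definition subsets_of_card :: "'a set \<Rightarrow> nat \<Rightarrow> 'a set set" where
  "subsets_of_card P k = {T. T \<subseteq> P \<and> card T = k}"

definition elem_sym :: "'a set \<Rightarrow> ('a \<Rightarrow> real) \<Rightarrow> nat \<Rightarrow> real" where
  "elem_sym P w k = (\<Sum>T\<in>subsets_of_card P k. \<Prod>p\<in>T. w p)"

lemma finite_subsets_of_card [simp]: "finite P \<Longrightarrow> finite (subsets_of_card P k)"
  by (simp add: subsets_of_card_def)

lemma elem_sym_0: "finite P \<Longrightarrow> elem_sym P w 0 = 1"
proof -
  assume "finite P"
  hence "subsets_of_card P 0 = {{}}"
    by (auto simp: subsets_of_card_def dest: finite_subset)
  thus ?thesis by (simp add: elem_sym_def)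
qed

text \<open>Marking an element \<open>p\<close> of \<open>T\<close> and removing it matches the
  pairs with \<open>p\<close> in \<open>T\<close> to those with \<open>p\<close> in
  \<open>P - U\<close>. With \<open>g = 1\<close> this is the recursion for \<open>elem_sym\<close>;
  \<open>g = w\<close> and \<open>g = ln\<close> serve to estimate errors.\<close>

lemma sum_subsets_Suc_weighted:
  fixes w g :: "'a \<Rightarrow> real"
  assumes "finite P"
  shows "(\<Sum>T\<in>subsets_of_card P (Suc k). (\<Prod>p\<in>T. w p) * (\<Sum>p\<in>T. g p)) =
         (\<Sum>U\<in>subsets_of_card P k. (\<Prod>p\<in>U. w p) * (\<Sum>p\<in>P-U. g p * w p))"
proof -
  have fin: "finite T" if "T \<in> subsets_of_card P k" for T k
    using that finite_subset[OF _ assms] by (simp add: subsets_of_card_def)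
  have "(\<Sum>T\<in>subsets_of_card P (Suc k). (\<Prod>p\<in>T. w p) * (\<Sum>p\<in>T. g p)) =
        (\<Sum>(T, p)\<in>Sigma (subsets_of_card P (Suc k)) (\<lambda>T. T). (\<Prod>p\<in>T. w p) * g p)"
    unfolding sum_distrib_left using assms fin by (subst sum.Sigma) auto
  also have "\<dots> = (\<Sum>(U, p)\<in>Sigma (subsets_of_card P k) (\<lambda>U. P - U). (\<Prod>p\<in>U. w p) * (g p * w p))"
  proof (rule sum.reindex_bij_witness[where i = "\<lambda>(U, p). (insert p U, p)"
          and j = "\<lambda>(T, p). (T - {p}, p)"])
    fix a assume a: "a \<in> Sigma (subsets_of_card P (Suc k)) (\<lambda>T. T)"
    obtain T p where Tp: "a = (T, p)" by (cases a)
    have T: "finite T" "T \<subseteq> P" "card T = Suc k" "p \<in> T"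
      using a Tp fin[of T "Suc k"] by (auto simp: subsets_of_card_def)
    have "(\<Prod>p\<in>T. w p) = w p * (\<Prod>p\<in>T - {p}. w p)"
      using T by (intro prod.remove) auto
    thus "(case (case a of (T, p) \<Rightarrow> (T - {p}, p)) of (U, p) \<Rightarrow> (\<Prod>p\<in>U. w p) * (g p * w p)) =
          (case a of (T, p) \<Rightarrow> (\<Prod>p\<in>T. w p) * g p)"
      by (simp add: Tp)
    show "(case (case a of (T, p) \<Rightarrow> (T - {p}, p)) of (U, p) \<Rightarrow> (insert p U, p)) = a"
      using T Tp by auto
    show "(case a of (T, p) \<Rightarrow> (T - {p}, p)) \<in> Sigma (subsets_of_card P k) (\<lambda>U. P - U)"
      using T Tp by (auto simp: subsets_of_card_def)
  next
    fix b assume b: "b \<in> Sigma (subsets_of_card P k) (\<lambda>U. P - U)"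
    obtain U p where Up: "b = (U, p)" by (cases b)
    have U: "finite U" "U \<subseteq> P" "card U = k" "p \<in> P" "p \<notin> U"
      using b Up fin[of U k] by (auto simp: subsets_of_card_def)
    show "(case (case b of (U, p) \<Rightarrow> (insert p U, p)) of (T, p) \<Rightarrow> (T - {p}, p)) = b"
      using U Up by auto
    show "(case b of (U, p) \<Rightarrow> (insert p U, p)) \<in> Sigma (subsets_of_card P (Suc k)) (\<lambda>T. T)"
      using U Up by (auto simp: subsets_of_card_def)
  qed
  also have "\<dots> = (\<Sum>U\<in>subsets_of_card P k. (\<Prod>p\<in>U. w p) * (\<Sum>p\<in>P-U. g p * w p))"
    unfolding sum_distrib_left using assms by (subst sum.Sigma) auto
  finally show ?thesis .
qed

lemma sum_subsets_Suc_weighted_le: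
  fixes w g :: "'a \<Rightarrow> real"
  assumes "finite P" and w: "\<And>p. p \<in> P \<Longrightarrow> w p \<ge> 0" and g: "\<And>p. p \<in> P \<Longrightarrow> g p \<ge> 0"
  shows "(\<Sum>T\<in>subsets_of_card P (Suc k). (\<Prod>p\<in>T. w p) * (\<Sum>p\<in>T. g p)) \<le>
         (\<Sum>p\<in>P. g p * w p) * elem_sym P w k"
proof -
  have "(\<Sum>T\<in>subsets_of_card P (Suc k). (\<Prod>p\<in>T. w p) * (\<Sum>p\<in>T. g p)) \<le>
        (\<Sum>U\<in>subsets_of_card P k. (\<Prod>p\<in>U. w p) * (\<Sum>p\<in>P. g p * w p))"
    unfolding sum_subsets_Suc_weighted[OF assms(1)] using assms
    by (intro sum_mono mult_left_mono sum_mono2 prod_nonneg)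
       (auto simp: subsets_of_card_def)
  also have "\<dots> = (\<Sum>p\<in>P. g p * w p) * elem_sym P w k"
    by (simp add: elem_sym_def sum_distrib_right mult.commute)
  finally show ?thesis .
qed

lemma Suc_mult_elem_sym:
  "real (Suc k) * elem_sym P w (Suc k) =
     (\<Sum>T\<in>subsets_of_card P (Suc k). (\<Prod>p\<in>T. w p) * (\<Sum>p\<in>T. 1))"
  unfolding elem_sym_def sum_distrib_left
  by (intro sum.cong) (auto simp: subsets_of_card_def simp del: of_nat_Suc)

lemma elem_sym_le:
  assumes "finite P" and w: "\<And>p. p \<in> P \<Longrightarrow> w p \<ge> 0"
  shows "elem_sym P w k \<le> (\<Sum>p\<in>P. w p) ^ k / fact k"
proof (induction k)
  case (Suc k)
  have "real (Suc k) * elem_sym P w (Suc k) \<le> (\<Sum>p\<in>P. w p) * elem_sym P w k"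
    using sum_subsets_Suc_weighted_le[of P w "\<lambda>_. 1"] assms
    unfolding Suc_mult_elem_sym by simp
  also have "\<dots> \<le> (\<Sum>p\<in>P. w p) * ((\<Sum>p\<in>P. w p) ^ k / fact k)"
    using w by (intro mult_left_mono Suc sum_nonneg) auto
  finally have "elem_sym P w (Suc k) * real (Suc k) \<le> (\<Sum>p\<in>P. w p) ^ Suc k / fact k"
    by (simp add: mult.commute)
  hence "elem_sym P w (Suc k) \<le> (\<Sum>p\<in>P. w p) ^ Suc k / fact k / real (Suc k)"
    by (subst pos_le_divide_eq) auto
  thus ?case by (simp add: mult_ac)
qed (use assms in \<open>simp add: elem_sym_0\<close>)

text \<open>The full power \<open>E ^ k\<close> also counts choices with repeated elements. Each
  step of the recursion corrects for a new element already in \<open>U\<close>, which costs a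
  diagonal term controlled by the sum of squares \<open>S\<close>.\<close>

lemma elem_sym_ge:
  assumes "finite P" and w: "\<And>p. p \<in> P \<Longrightarrow> w p \<ge> 0" and pos: "(\<Sum>p\<in>P. w p) > 0"
  defines "E \<equiv> \<Sum>p\<in>P. w p" and "S \<equiv> \<Sum>p\<in>P. w p ^ 2"
  shows "elem_sym P w k \<ge> E ^ k / fact k * (1 - S * real k ^ 2 / E ^ 2)"
proof (induction k)
  case (Suc k)
  have E: "E > 0" using pos by (simp add: E_def)
  have S: "S \<ge> 0" unfolding S_def by (intro sum_nonneg) auto
  \<comment> \<open>Marking an element with weight \<open>w\<close> squares its weight, so this sum
    is at most \<open>S\<close> times \<open>elem_sym\<close> of index \<open>k - 1\<close>.\<close>
  have diag: "(\<Sum>U\<in>subsets_of_card P k. (\<Prod>p\<in>U. w p) * (\<Sum>p\<in>U. w p)) \<le>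
                S * (real k * E ^ k / (fact k * E))"
  proof (cases k)
    case 0
    hence "subsets_of_card P k = {{}}"
      using \<open>finite P\<close> by (auto simp: subsets_of_card_def dest: finite_subset)
    thus ?thesis using 0 by simp
  next
    case k: (Suc j)
    have "(\<Sum>U\<in>subsets_of_card P k. (\<Prod>p\<in>U. w p) * (\<Sum>p\<in>U. w p)) \<le> S * elem_sym P w j"
      using sum_subsets_Suc_weighted_le[of P w w j] assms(1,2) k
      by (simp add: S_def power2_eq_square)
    also have "\<dots> \<le> S * (E ^ j / fact j)"
      unfolding E_def using S assms(1,2) by (intro mult_left_mono elem_sym_le) auto
    also have "E ^ j / fact j = real k * E ^ k / (fact k * E)"
      using k E by (simp add: divide_simps)
    finally show ?thesis .
  qed
  have "real (Suc k) * elem_sym P w (Suc k) =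
          (\<Sum>U\<in>subsets_of_card P k. (\<Prod>p\<in>U. w p) * (\<Sum>p\<in>P-U. w p))"
    unfolding Suc_mult_elem_sym sum_subsets_Suc_weighted[OF assms(1)] by simp
  also have "\<dots> = (\<Sum>U\<in>subsets_of_card P k. (\<Prod>p\<in>U. w p) * (E - (\<Sum>p\<in>U. w p)))"
    unfolding E_def using assms(1)
    by (intro sum.cong refl) (auto simp: subsets_of_card_def sum_diff)
  also have "\<dots> = E * elem_sym P w k -
               (\<Sum>U\<in>subsets_of_card P k. (\<Prod>p\<in>U. w p) * (\<Sum>p\<in>U. w p))"
    by (simp add: right_diff_distrib sum_subtractf elem_sym_def sum_distrib_left mult.commute)
  also have "\<dots> \<ge> E * (E ^ k / fact k * (1 - S * real k ^ 2 / E ^ 2)) -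
                  S * (real k * E ^ k / (fact k * E))"
    using diag Suc.IH E by (intro diff_mono mult_left_mono) auto
  also have "E * (E ^ k / fact k * (1 - S * real k ^ 2 / E ^ 2)) - S * (real k * E ^ k / (fact k * E)) =
             E ^ Suc k / fact k * (1 - S * (real k ^ 2 + real k) / E ^ 2)"
    using E by (simp add: divide_simps) (simp add: algebra_simps power2_eq_square)
  \<comment> \<open>The accumulated loss \<open>k ^ 2 + k\<close> is absorbed by
    \<open>(k + 1) ^ 2\<close>.\<close>
  also have "\<dots> \<ge> E ^ Suc k / fact k * (1 - S * real (Suc k) ^ 2 / E ^ 2)"
    using E S by (intro mult_left_mono diff_left_mono divide_right_mono)
      (auto simp: power2_eq_square algebra_simps)
  finally have "E ^ Suc k / fact k * (1 - S * real (Suc k) ^ 2 / E ^ 2) / real (Suc k) \<le>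
                elem_sym P w (Suc k)"
    by (subst pos_divide_le_eq) (auto simp: mult.commute)
  thus ?case by (simp add: mult_ac)
qed (use assms in \<open>simp add: elem_sym_0\<close>)

text \<open>\<open>squares\<close> keeps half of \<open>E ^ k / fact k\<close> in the full symmetric
  sum. By a Markov inequality for \<open>ln\<close> of the product, \<open>logs\<close> limits the
  part with product above \<open>D\<close> to a quarter.\<close>

lemma truncated_elem_sym_ge:
  fixes P :: "nat set" and D :: real
  assumes "finite P" and P: "\<And>p. p \<in> P \<Longrightarrow> p \<ge> 1" and "k \<ge> 1" and "D > 1"
    and pos: "(\<Sum>p\<in>P. 1 / real p) > 0"
  defines "E \<equiv> \<Sum>p\<in>P. 1 / real p"
  assumes squares: "(\<Sum>p\<in>P. (1 / real p) ^ 2) * real k ^ 2 / E ^ 2 \<le> 1 / 2"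
    and logs: "(\<Sum>p\<in>P. ln (real p) / real p) * real k / (E * ln D) \<le> 1 / 4"
  shows "(\<Sum>T | T \<in> subsets_of_card P k \<and> real (\<Prod>T) \<le> D. 1 / real (\<Prod>T)) \<ge> E ^ k / (4 * fact k)"
proof -
  define w where "w = (\<lambda>p::nat. 1 / real p)"
  define W where "W = (\<lambda>T. \<Prod>p\<in>T. w p)"
  define K where "K = subsets_of_card P k"
  have fin [simp]: "finite K" using assms(1) by (simp add: K_def)
  have E: "E > 0" using pos by (simp add: E_def)
  have lnD: "ln D > 0" using \<open>D > 1\<close> by simp
  obtain j where j: "k = Suc j" using \<open>k \<ge> 1\<close> by (cases k) auto
  have W_eq: "W T = 1 / real (\<Prod>T)" for T
    by (simp add: W_def w_def prod_dividef)
  have W_nonneg: "W T \<ge> 0" for T by (simp add: W_eq prod_nonneg)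
  have "E ^ k / fact k * (1 / 2) \<le> E ^ k / fact k * (1 - (\<Sum>p\<in>P. w p ^ 2) * real k ^ 2 / E ^ 2)"
    using squares E by (intro mult_left_mono) (auto simp: w_def)
  also have "\<dots> \<le> elem_sym P w k"
    using elem_sym_ge[of P w k] assms(1) pos by (simp add: w_def E_def)
  also have "\<dots> = (\<Sum>T\<in>K. W T)"
    by (simp add: elem_sym_def K_def W_def)
  also have "\<dots> = (\<Sum>T | T \<in> K \<and> real (\<Prod>T) \<le> D. W T) + (\<Sum>T | T \<in> K \<and> real (\<Prod>T) > D. W T)"
    by (subst sum.union_disjoint [symmetric]) (auto intro!: sum.cong)
  also have "(\<Sum>T | T \<in> K \<and> real (\<Prod>T) > D. W T) \<le> E ^ k / fact k * (1 / 4)"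
  proof -
    have ln_prod: "ln (real (\<Prod>T)) = (\<Sum>p\<in>T. ln (real p))" if "T \<in> K" for T
    proof -
      have "T \<subseteq> P" using that by (simp add: K_def subsets_of_card_def)
      moreover from this have "finite T" using assms(1) by (rule finite_subset)
      ultimately show ?thesis unfolding of_nat_prod using P by (intro ln_prod) fastforce+
    qed
    have ln_nonneg: "ln (real p) \<ge> 0" if "p \<in> P" for p using P[OF that] by simp
    have "ln D * (\<Sum>T | T \<in> K \<and> real (\<Prod>T) > D. W T) =
            (\<Sum>T | T \<in> K \<and> real (\<Prod>T) > D. W T * ln D)"
      by (simp add: sum_distrib_left mult.commute)
    also have "\<dots> \<le> (\<Sum>T | T \<in> K \<and> real (\<Prod>T) > D. W T * (\<Sum>p\<in>T. ln (real p)))"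
    proof (intro sum_mono mult_left_mono W_nonneg)
      fix T assume T: "T \<in> {T. T \<in> K \<and> real (\<Prod>T) > D}"
      hence "ln D \<le> ln (real (\<Prod>T))" using \<open>D > 1\<close> by (intro ln_mono) auto
      thus "ln D \<le> (\<Sum>p\<in>T. ln (real p))" using T ln_prod by simp
    qed
    also have "\<dots> \<le> (\<Sum>T\<in>K. W T * (\<Sum>p\<in>T. ln (real p)))"
      using ln_nonneg
      by (intro sum_mono2[OF fin] mult_nonneg_nonneg W_nonneg sum_nonneg) (auto simp: K_def subsets_of_card_def)
    also have "\<dots> \<le> (\<Sum>p\<in>P. ln (real p) * w p) * elem_sym P w j"
      unfolding K_def j W_def
      using assms(1) ln_nonneg by (intro sum_subsets_Suc_weighted_le) (auto simp: w_def)
    also have "\<dots> \<le> (\<Sum>p\<in>P. ln (real p) * w p) * (E ^ j / fact j)"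
      unfolding E_def using elem_sym_le[of P w j] assms(1) ln_nonneg
      by (intro mult_left_mono sum_nonneg) (auto simp: w_def)
    also have "E ^ j / fact j = E ^ k / fact k * (real k / E)"
      using j E by (simp add: divide_simps)
    also have "(\<Sum>p\<in>P. ln (real p) * w p) * (E ^ k / fact k * (real k / E)) =
               E ^ k / fact k * ((\<Sum>p\<in>P. ln (real p) / real p) * real k / (E * ln D)) * ln D"
      using lnD by (simp add: w_def)
    also have "\<dots> \<le> E ^ k / fact k * (1 / 4) * ln D"
      using logs E lnD by (intro mult_right_mono mult_left_mono) auto
    finally have "ln D * (\<Sum>T | T \<in> K \<and> real (\<Prod>T) > D. W T) \<le> ln D * (E ^ k / fact k * (1 / 4))"
      by (simp only: mult_ac)
    thus ?thesis using lnD by (rule mult_left_le_imp_le)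
  qed
  finally show ?thesis by (simp add: W_eq K_def field_simps)
qed

section \<open>From sets of primes to integers with \<open>k\<close> small prime factors\<close>

lemma nu_prod_primes:
  assumes "T \<subseteq> primes_le y"
  shows "nu (\<Prod>T) y = card T"
proof -
  have "finite T" using assms finite_primes_le by (rule finite_subset)
  hence "{p. prime p \<and> p dvd \<Prod>T \<and> real p \<le> y} = T"
    using assms by (auto simp: prime_dvd_prod_primes_iff primes_le_def subset_iff)
  thus ?thesis by (simp add: nu_def)
qed

text \<open>The products of a rough \<open>b\<close> with the elements of \<open>T\<close> are
  distinct, since \<open>T\<close> is recovered as the set of small prime divisors and then
  determines \<open>b\<close>.\<close>

lemma recip_sum_ge:
  assumes "P \<subseteq> primes_le y"
  shows "(\<Sum>T | T \<in> subsets_of_card P k \<and> real (\<Prod>T) \<le> real D. 1 / real (\<Prod>T)) * recip_sum {1..D} y 0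
           \<le> recip_sum {1..D * D} y k"
proof -
  define K where "K = {T. T \<in> subsets_of_card P k \<and> real (\<Prod>T) \<le> real D}"
  define R where "R = {b. b \<in> {1..D} \<and> nu b y = 0}"
  have "finite P" using assms finite_primes_le by (rule finite_subset)
  hence fin [simp]: "finite K" "finite R" by (simp_all add: K_def R_def)
  have K: "finite T" "T \<subseteq> primes_le y" "card T = k" "\<Prod>T \<ge> 1" "\<Prod>T \<le> D" "\<And>p. p \<in> T \<Longrightarrow> prime p"
    if "T \<in> K" for T
  proof -
    show T: "T \<subseteq> primes_le y" "card T = k" "\<Prod>T \<le> D"
      using that assms by (auto simp: K_def subsets_of_card_def simp del: of_nat_prod)
    show "finite T" using T(1) finite_primes_le by (rule finite_subset)
    show prime: "prime p" if "p \<in> T" for p using T that by (auto simp: primes_le_def)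
    have "\<Prod>T > 0" by (intro prod_pos ballI prime_gt_0_nat prime)
    thus "\<Prod>T \<ge> 1" by linarith
  qed
  have small: "{p. prime p \<and> p dvd b * \<Prod>T \<and> real p \<le> y} = T" if "T \<in> K" "b \<in> R" for T b
    using K[OF that(1)] that
    by (auto simp: R_def prime_dvd_mult_iff prime_dvd_prod_primes_iff nu_eq_0_iff primes_le_def
             simp flip: not_le)
  have inj: "inj_on (\<lambda>(T, b). b * \<Prod>T) (K \<times> R)"
  proof (rule inj_onI, safe)
    fix T b T' b' assume H: "T \<in> K" "T' \<in> K" "b \<in> R" "b' \<in> R" "b * \<Prod>T = b' * \<Prod>T'"
    have "T = T'" using small[of T b] small[of T' b'] H by simp
    moreover from this have "b = b'" using H K(4)[of T] by simp
    ultimately show "x \<in> T \<Longrightarrow> x \<in> T'" "x \<in> T' \<Longrightarrow> x \<in> T" "b = b'" for x by auto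
  qed
  have "(\<Sum>T\<in>K. 1 / real (\<Prod>T)) * recip_sum {1..D} y 0 = (\<Sum>(T, b)\<in>K \<times> R. 1 / real (b * \<Prod>T))"
    unfolding recip_sum_def R_def [symmetric]
    unfolding sum_product sum.cartesian_product by (intro sum.cong) (auto simp: mult.commute)
  also have "\<dots> = (\<Sum>n\<in>(\<lambda>(T, b). b * \<Prod>T) ` (K \<times> R). 1 / real n)"
    by (subst sum.reindex[OF inj]) (auto intro!: sum.cong)
  also have "\<dots> \<le> recip_sum {1..D * D} y k"
    unfolding recip_sum_def
  proof (rule sum_mono2)
    show "(\<lambda>(T, b). b * \<Prod>T) ` (K \<times> R) \<subseteq> {m. m \<in> {1..D * D} \<and> nu m y = k}"
    proof safe
      fix T b assume H: "T \<in> K" "b \<in> R"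
      have b: "b \<ge> 1" "b \<le> D" "nu b y = 0" using H by (auto simp: R_def)
      show "nu (b * \<Prod>T) y = k"
        using nu_mult_rough[OF b(3)] nu_prod_primes[OF K(2)] K(3) H by simp
      have "1 * 1 \<le> b * \<Prod>T" "b * \<Prod>T \<le> D * D" using K[OF H(1)] b by (auto intro!: mult_le_mono)
      thus "b * \<Prod>T \<in> {1..D * D}" by simp
    qed
  qed auto
  finally show ?thesis by (simp add: K_def)
qed

section \<open>The lower bound\<close>

lemma card_primes_le: "y \<ge> 0 \<Longrightarrow> real (card (primes_le y)) \<le> y"
proof -
  assume y: "y \<ge> 0"
  have "card (primes_le y) \<le> card {1..nat \<lfloor>y\<rfloor>}"
    by (intro card_mono) (auto simp: primes_le_def le_nat_floor Suc_le_eq prime_gt_0_nat)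
  thus ?thesis using y by simp linarith
qed

text \<open>Only powers of primes \<open>p <= y\<close> contribute. For each \<open>p\<close> there
  are at most \<open>ln t / ln p\<close> exponents, each of weight \<open>ln p\<close>, so every
  such prime contributes at most \<open>ln t\<close>.\<close>

lemma sum_mangoldt_not_rough_le:
  assumes "y \<ge> 0" and "t \<ge> 1"
  shows "(\<Sum>d | d \<in> {1..t} \<and> nu d y \<noteq> 0. mangoldt d) \<le> y * ln (real t)"
proof -
  define J where "J = (\<lambda>p::nat. {j. 1 \<le> j \<and> p ^ j \<le> t})"
  have J_sub: "J p \<subseteq> {1..nat \<lfloor>ln (real t) / ln (real p)\<rfloor>}" if "p \<in> primes_le y" for p
  proof
    fix j assume j: "j \<in> J p"
    have p: "p > 1" using that by (simp add: primes_le_def prime_gt_Suc_0_nat)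
    have "real p ^ j \<le> real t" using j by (simp add: J_def flip: of_nat_power)
    hence "ln (real p ^ j) \<le> ln (real t)" using p by (intro ln_mono) auto
    hence "real j * ln (real p) \<le> ln (real t)" using p by (simp add: ln_realpow)
    hence "real j \<le> ln (real t) / ln (real p)" using p by (simp add: pos_le_divide_eq)
    thus "j \<in> {1..nat \<lfloor>ln (real t) / ln (real p)\<rfloor>}"
      using j by (simp add: J_def le_nat_floor)
  qed
  have finJ: "finite (J p)" if "p \<in> primes_le y" for p
    using J_sub[OF that] by (rule finite_subset) auto
  have "(\<Sum>d | d \<in> {1..t} \<and> nu d y \<noteq> 0. mangoldt d) =
          (\<Sum>d | d \<in> {1..t} \<and> nu d y \<noteq> 0 \<and> primepow d. mangoldt d :: real)"
    by (intro sum.mono_neutral_right) (auto simp: mangoldt_def)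
  also have "\<dots> \<le> (\<Sum>(p, j)\<in>Sigma (primes_le y) J. ln (real p))"
  proof (rule sum_le_included[where i = "\<lambda>(p, j). p ^ j"])
    show "\<forall>d\<in>{d. d \<in> {1..t} \<and> nu d y \<noteq> 0 \<and> primepow d}. \<exists>b\<in>Sigma (primes_le y) J.
            (case b of (p, j) \<Rightarrow> p ^ j) = d \<and> mangoldt d \<le> (case b of (p, j) \<Rightarrow> ln (real p))"
    proof
      fix d assume "d \<in> {d. d \<in> {1..t} \<and> nu d y \<noteq> 0 \<and> primepow d}"
      hence d: "d \<in> {1..t}" "nu d y \<noteq> 0" "primepow d" by auto
      then obtain p j where pj: "prime p" "j > 0" "d = p ^ j" by (auto simp: primepow_def)
      from d obtain q where q: "prime q" "q dvd d" "real q \<le> y"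
        by (auto simp: nu_eq_0_iff not_less)
      hence "q = p" using prime_dvd_prime_power_mult_iff[of p q j 1] pj by (metis mult_1_right not_prime_unit)
      hence "(p, j) \<in> Sigma (primes_le y) J"
        using q pj d by (auto simp: primes_le_def J_def)
      thus "\<exists>b\<in>Sigma (primes_le y) J. (case b of (p, j) \<Rightarrow> p ^ j) = d \<and>
              mangoldt d \<le> (case b of (p, j) \<Rightarrow> ln (real p))"
        using pj by (intro bexI[of _ "(p, j)"]) auto
    qed
    show "finite (Sigma (primes_le y) J)" using finJ by (intro finite_SigmaI) auto
  qed (auto simp: primes_le_def Suc_le_eq prime_gt_0_nat)
  also have "\<dots> = (\<Sum>p\<in>primes_le y. real (card (J p)) * ln (real p))"
    using finJ by (subst sum.Sigma [symmetric]) auto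
  also have "\<dots> \<le> (\<Sum>p\<in>primes_le y. ln (real t))"
  proof (rule sum_mono)
    fix p assume p: "p \<in> primes_le y"
    hence "p > 1" by (simp add: primes_le_def prime_gt_Suc_0_nat)
    hence lnp: "ln (real p) > 0" by simp
    have "card (J p) \<le> card {1..nat \<lfloor>ln (real t) / ln (real p)\<rfloor>}"
      using J_sub[OF p] by (intro card_mono) auto
    hence "card (J p) \<le> nat \<lfloor>ln (real t) / ln (real p)\<rfloor>" by simp
    moreover have "0 \<le> ln (real t) / ln (real p)" using lnp assms by simp
    ultimately have "real (card (J p)) \<le> ln (real t) / ln (real p)" by linarith
    thus "real (card (J p)) * ln (real p) \<le> ln (real t)"
      using lnp by (simp add: pos_le_divide_eq)
  qed
  also have "\<dots> = real (card (primes_le y)) * ln (real t)" by simp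
  also have "\<dots> \<le> y * ln (real t)"
    using assms by (intro mult_right_mono card_primes_le) auto
  finally show ?thesis .
qed

lemma psi_le_rough_sum:
  assumes "y \<ge> 0" and "t \<ge> 1"
  shows "psi t - y * ln (real t) \<le> (\<Sum>d | d \<in> {1..t} \<and> nu d y = 0. mangoldt d)"
proof -
  have "psi t = (\<Sum>d | d \<in> {1..t} \<and> nu d y = 0. mangoldt d) +
                (\<Sum>d | d \<in> {1..t} \<and> nu d y \<noteq> 0. mangoldt d)"
    unfolding psi_def by (subst sum.union_disjoint [symmetric]) (auto intro!: sum.cong)
  thus ?thesis using sum_mangoldt_not_rough_le[OF assms] by simp
qed

text \<open>Multiplying \<open>m\<close> by a rough \<open>d\<close> leaves \<open>nu\<close>
  unchanged. For each \<open>n = d * m\<close>, the weights \<open>mangoldt d\<close> of its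
  divisors add up to at most \<open>ln n\<close>.\<close>

lemma card_mult_ln_ge:
  assumes "X \<ge> 1" and "M \<le> X"
  shows "(\<Sum>m | m \<in> {1..M} \<and> nu m y = k. \<Sum>d | d \<in> {1..X div m} \<and> nu d y = 0. mangoldt d) \<le>
           real (card {n \<in> {1..X}. nu n y = k}) * ln (real X)"
proof -
  define A where "A = {m. m \<in> {1..M} \<and> nu m y = k}"
  define B where "B = (\<lambda>m. {d. d \<in> {1..X div m} \<and> nu d y = 0})"
  define R where "R = {n \<in> {1..X}. nu n y = k}"
  have fin [simp]: "finite A" "finite R" "finite (B m)" for m by (auto simp: A_def B_def R_def)
  have "(\<Sum>m\<in>A. \<Sum>d\<in>B m. mangoldt d) = (\<Sum>(m, d)\<in>Sigma A B. mangoldt d :: real)"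
    by (subst sum.Sigma) auto
  also have "\<dots> \<le> (\<Sum>(n, d)\<in>Sigma R (\<lambda>n. {d. d dvd n}). mangoldt d)"
  proof (rule sum_le_included[where i = "\<lambda>(n, d). (n div d, d)"])
    show "\<forall>a\<in>Sigma A B. \<exists>b\<in>Sigma R (\<lambda>n. {d. d dvd n}).
            (case b of (n, d) \<Rightarrow> (n div d, d)) = a \<and>
            ((case a of (m, d) \<Rightarrow> mangoldt d) :: real) \<le> (case b of (n, d) \<Rightarrow> mangoldt d)"
    proof safe
      fix m d assume m: "m \<in> A" and d: "d \<in> B m"
      have m': "m \<ge> 1" "nu m y = k" using m by (auto simp: A_def)
      have d': "d \<ge> 1" "nu d y = 0" "d \<le> X div m" using d by (auto simp: B_def)
      have "d * m \<le> X" using d' m' by (simp add: less_eq_div_iff_mult_less_eq)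
      hence "d * m \<in> R" using m' d' nu_mult_rough[OF d'(2)] by (auto simp: R_def)
      thus "\<exists>b\<in>Sigma R (\<lambda>n. {d. d dvd n}). (case b of (n, d) \<Rightarrow> (n div d, d)) = (m, d) \<and>
            (mangoldt d :: real) \<le> (case b of (n, d) \<Rightarrow> mangoldt d)"
        using d' by (intro bexI[of _ "(d * m, d)"]) auto
    qed
  qed (auto simp: mangoldt_nonneg R_def)
  also have "\<dots> = (\<Sum>n\<in>R. \<Sum>d | d dvd n. mangoldt d)"
    by (subst sum.Sigma) (auto simp: R_def)
  also have "\<dots> = (\<Sum>n\<in>R. ln (real n))"
    using mangoldt_sum[where ?'a = real] by (intro sum.cong) (auto simp: R_def)
  also have "\<dots> \<le> (\<Sum>n\<in>R. ln (real X))"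
    by (intro sum_mono) (auto simp: R_def)
  finally show ?thesis by (simp add: A_def B_def R_def)
qed

text \<open>For \<open>m <= x powr (c / 2)\<close> the range of \<open>d\<close> has length of order
  \<open>x / m\<close>, hence at least of order \<open>x powr (1 - c / 2)\<close>. This beats
  \<open>y * ln x\<close> by a power of \<open>x\<close>, so the prime powers of small primes are
  negligible against \<open>psi\<close>.\<close>

lemma N_count_ge_recip_sum:
  fixes c x y :: real
  assumes c: "0 < c" "c < 1"
    and large: "x \<ge> 1" "x powr (1 - c / 2) \<ge> 4000" "x powr (1 - c) * ln x \<le> x powr (1 - c / 2) / 8000"
    and y: "0 \<le> y" "y \<le> x powr (1 - c)" and M: "real M \<le> x powr (c / 2)"
  shows "x / 8000 * recip_sum {1..M} y k \<le> real (N_count k x y) * ln x"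
proof -
  define X where "X = nat \<lfloor>x\<rfloor>"
  have X: "X \<ge> 1" "real X \<le> x" "x < real X + 1" using large by (auto simp: X_def le_nat_floor)
  have "x powr (c / 2) \<le> x powr 1" using large c by (intro powr_mono) auto
  hence "real M \<le> x" using M large by simp
  hence MX: "M \<le> X" by (simp add: X_def le_nat_floor)
  have "x / 8000 * recip_sum {1..M} y k = (\<Sum>m | m \<in> {1..M} \<and> nu m y = k. x / 8000 * (1 / real m))"
    by (simp add: recip_sum_def sum_distrib_left)
  also have "\<dots> \<le> (\<Sum>m | m \<in> {1..M} \<and> nu m y = k. \<Sum>d | d \<in> {1..X div m} \<and> nu d y = 0. mangoldt d)"
  proof (rule sum_mono)
    fix m assume "m \<in> {m. m \<in> {1..M} \<and> nu m y = k}"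
    hence m: "m \<ge> 1" "m \<le> M" by auto
    define t where "t = X div m"
    have "x powr (1 - c / 2) * real m \<le> x powr (1 - c / 2) * x powr (c / 2)"
      using m M by (intro mult_left_mono) auto
    also have "\<dots> = x" using large by (simp flip: powr_add)
    finally have xm: "x powr (1 - c / 2) \<le> x / real m"
      using m by (simp add: pos_le_divide_eq)
    \<comment> \<open>Rounding \<open>x\<close> and then the quotient loses at most 2 in total; as
      \<open>x / m >= 4000\<close>, at least half of it remains.\<close>
    have "x / real m \<le> real X / real m + 1 / real m"
      using X m by (simp add: divide_simps)
    moreover have "real X / real m < real t + 1" using real_nat_div_gt by (simp add: t_def)
    moreover have "1 / real m \<le> 1" using m by simp
    ultimately have "real t \<ge> 1 / 2 * (x / real m)" "real t \<ge> 1000"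
      using xm large by linarith+
    hence t: "real t \<ge> x / real m / 2" "real t \<ge> 1000" by simp_all
    have "real t \<le> real X / real m" unfolding t_def by (rule real_nat_div_le)
    also have "\<dots> \<le> real X / 1" using m by (intro divide_left_mono) auto
    finally have "real t \<le> x" using X by simp
    have "y * ln (real t) \<le> x powr (1 - c) * ln x"
      using y t \<open>real t \<le> x\<close> by (intro mult_mono) auto
    also have "\<dots> \<le> x powr (1 - c / 2) / 8000" using large by simp
    also have "\<dots> \<le> x / real m / 8000" using xm by (intro divide_right_mono) auto
    finally have "y * ln (real t) \<le> x / real m / 8000" .
    moreover have "psi t \<ge> real t / 2000" using t by (intro psi_ge) simp
    \<comment> \<open>\<open>psi t\<close> is at least \<open>x / (4000 * m)\<close>, and half of
      that pays for the non-rough part.\<close>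
    ultimately have "x / 8000 * (1 / real m) \<le> psi t - y * ln (real t)"
      using t by simp
    also have "\<dots> \<le> (\<Sum>d | d \<in> {1..t} \<and> nu d y = 0. mangoldt d)"
      using y t by (intro psi_le_rough_sum) auto
    finally show "x / 8000 * (1 / real m) \<le> (\<Sum>d | d \<in> {1..X div m} \<and> nu d y = 0. mangoldt d)"
      by (simp add: t_def)
  qed
  also have "\<dots> \<le> real (card {n \<in> {1..X}. nu n y = k}) * ln (real X)"
    using X MX by (intro card_mult_ln_ge) auto
  also have "\<dots> = real (N_count k x y) * ln (real X)"
    using large by (simp add: N_count_eq X_def)
  also have "\<dots> \<le> real (N_count k x y) * ln x"
    using X by (intro mult_left_mono) auto
  finally show ?thesis .
qed

section \<open>Bounded \<open>y\<close>: a positive proportion from an arithmetic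
  progression\<close>

lemma prod_primes_dvd:
  fixes n :: nat
  assumes "finite T" and "\<And>p. p \<in> T \<Longrightarrow> prime p \<and> p dvd n"
  shows "\<Prod>T dvd n"
  using assms
proof (induction T rule: finite_induct)
  case (insert p T)
  have "coprime p (\<Prod>T)"
    using insert by (intro prod_coprime_right) (auto intro!: primes_coprime)
  thus ?case using insert by (auto intro: divides_mult)
qed auto

text \<open>For bounded \<open>y\<close> one admissible \<open>n\<close> produces the positive proportion \<open>a * (1 + Q * j)\<close>, where
  \<open>a\<close> collects its small primes and \<open>Q\<close> is the product of all primes up to \<open>y\<close>.\<close>
lemma N_count_ge_proportion:
  assumes "x > 0" and "N_count k x y \<noteq> 0"
  defines "Q \<equiv> real (\<Prod>(primes_le y))"
  shows "x \<le> Q * (Q + 1) * real (N_count k x y)"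
proof -
  define q where "q = \<Prod>(primes_le y)"
  have "{n. 1 \<le> n \<and> real n \<le> x \<and> nu n y = k} \<noteq> {}"
    using assms(2) unfolding N_count_def by (metis card.empty)
  then obtain n where n: "n \<ge> 1" "real n \<le> x" "nu n y = k" by auto
  define T where "T = {p. prime p \<and> p dvd n \<and> real p \<le> y}"
  define a where "a = \<Prod>T"
  have T: "finite T" "T \<subseteq> primes_le y" "card T = k"
    using n by (auto simp: T_def primes_le_def nu_def)
  have q: "q > 0" unfolding q_def by (intro prod_pos) (auto simp: primes_le_def prime_gt_0_nat)
  have a: "a > 0" unfolding a_def by (intro prod_pos) (auto simp: T_def prime_gt_0_nat)
  have "a dvd n" unfolding a_def using T by (intro prod_primes_dvd) (auto simp: T_def)
  hence "a \<le> n" using n by (intro dvd_imp_le) auto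
  hence ax: "real a \<le> x" using n by linarith
  have "a dvd q" unfolding a_def q_def using T by (intro prod_dvd_prod_subset) auto
  hence aq: "a \<le> q" using q by (intro dvd_imp_le) auto
  \<comment> \<open>The number of \<open>j\<close> with \<open>a * (1 + q * j) <= x\<close>; the
    added 1 accounts for \<open>j = 0\<close>.\<close>
  define J where "J = nat \<lfloor>(x / real a - 1) / real q\<rfloor> + 1"
  have J0: "(x / real a - 1) / real q \<ge> 0" using ax a q by (simp add: field_simps)
  hence "(x / real a - 1) / real q < real J" unfolding J_def by linarith
  hence "x / real a - 1 < real J * real q" using q by (simp add: pos_divide_less_eq)
  moreover have "real J \<ge> 1" by (simp add: J_def)
  ultimately have "x / real a \<le> real J * (real q + 1)" by (simp add: algebra_simps)
  hence "x \<le> real a * (real q + 1) * real J" using a by (simp add: field_simps)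
  also have "\<dots> \<le> real q * (real q + 1) * real J"
    using aq by (intro mult_right_mono) auto
  also have "\<dots> \<le> real q * (real q + 1) * real (N_count k x y)"
  proof (intro mult_left_mono)
    have "J = card {..<J}" by simp
    also have "\<dots> \<le> N_count k x y"
      unfolding N_count_def
    proof (rule card_inj_on_le[where f = "\<lambda>j. (1 + q * j) * a"])
      show "inj_on (\<lambda>j. (1 + q * j) * a) {..<J}" using a q by (auto simp: inj_on_def)
      show "finite {n. 1 \<le> n \<and> real n \<le> x \<and> nu n y = k}"
        by (rule finite_subset[of _ "{..nat \<lfloor>x\<rfloor>}"]) (auto simp: le_nat_floor)
      show "(\<lambda>j. (1 + q * j) * a) ` {..<J} \<subseteq> {n. 1 \<le> n \<and> real n \<le> x \<and> nu n y = k}"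
      proof safe
        fix j assume "j < J"
        hence "j \<le> nat \<lfloor>(x / real a - 1) / real q\<rfloor>" by (simp add: J_def)
        hence "real j \<le> (x / real a - 1) / real q" using J0 by linarith
        thus "real ((1 + q * j) * a) \<le> x" using a q by (simp add: field_simps)
        have "0 < (1 + q * j) * a" using a by simp
        thus "1 \<le> (1 + q * j) * a" by linarith
        have "nu (1 + q * j) y = 0"
          unfolding nu_eq_0_iff
        proof (intro allI impI, rule ccontr)
          fix p assume p: "prime p \<and> p dvd 1 + q * j" "\<not> y < real p"
          hence "p dvd q" unfolding q_def by (intro dvd_prodI finite_primes_le) (auto simp: primes_le_def)
          hence "p dvd q * j" by simp
          hence "p dvd 1" using p dvd_add_left_iff[of p "q * j" 1] by blast
          thus False using p by simp
        qed
        hence "nu ((1 + q * j) * a) y = nu a y" by (rule nu_mult_rough)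
        also have "\<dots> = k" unfolding a_def using nu_prod_primes[OF T(2)] T(3) by simp
        finally show "nu ((1 + q * j) * a) y = k" .
      qed
    qed
    finally show "real J \<le> real (N_count k x y)" by simp
  qed auto
  finally show ?thesis by (simp add: Q_def q_def)
qed

text \<open>\<open>L ^ k / fact k\<close> is one term of the exponential series for
  \<open>exp L = ln y\<close>.\<close>

lemma main_term_le:
  assumes "x > 0" and "ln y > 0" and "ln (ln y) \<ge> 0"
  shows "main_term k x y \<le> x"
proof -
  define L where "L = ln (ln y)"
  have "(\<lambda>n. L ^ n / fact n) sums exp L"
    using exp_converges[of L] by (simp add: divide_inverse mult.commute)
  hence "L ^ k / fact k \<le> exp L"
    using sum_le_suminf[of "\<lambda>n. L ^ n / fact n" "{k}"] assms(3) by (simp add: sums_iff L_def)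
  also have "exp L = ln y" using assms by (simp add: L_def)
  finally have "x * (L ^ k / fact k) / ln y \<le> x * ln y / ln y"
    using assms by (intro divide_right_mono mult_left_mono) auto
  thus ?thesis using assms by (simp add: main_term_def L_def)
qed

lemma N_count_lower_bound:
  fixes c \<kappa> :: real
  assumes c: "0 < c" "c < 1" and \<kappa>: "0 < \<kappa>"
  shows "\<exists>C1 y0. 0 < C1 \<and> (\<forall>x y k. x > 0 \<and> y0 \<le> y \<and> 2 \<le> y \<and> y \<le> x powr (1 - c) \<and> 1 \<le> k \<and>
           real k \<le> ln (ln y) / \<kappa> \<longrightarrow> C1 * main_term k x y \<le> real (N_count k x y))"
proof -
  \<comment> \<open>Using only primes above \<open>P0\<close> bounds the sum of
    \<open>1 / p ^ 2\<close> by \<open>\<kappa>\<^sup>2 / 8\<close>; together with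
    \<open>k / E <= 2 / \<kappa>\<close> this gives the required 1/2.\<close>
  define P0 where "P0 = nat \<lceil>8 / \<kappa>\<^sup>2\<rceil> + 1"
  \<comment> \<open>Small enough that the sum of \<open>ln p / p\<close> over the primes up to
    \<open>y powr \<eta>\<close> is at most \<open>\<kappa> / 8 * ln D\<close>; multiplied by
    \<open>2 / \<kappa>\<close> this is the required 1/4.\<close>
  define \<eta> where "\<eta> = min 1 (c * \<kappa> / 128)"
  \<comment> \<open>The total deficit of \<open>E\<close> against \<open>L\<close>: the discarded
    small primes, the shift \<open>ln \<eta>\<close> from shortening the range, and 1 for replacing
    \<open>1 / (p - 1)\<close> by \<open>1 / p\<close>.\<close>
  define C3 where "C3 = 1 + (\<Sum>p\<in>primes_le (real P0). 1 / real p) - ln \<eta>"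
  \<comment> \<open>The denominator is \<open>8000 * 4 * 8\<close>: from the von Mangoldt count, the
    truncated symmetric sum and the bound \<open>ln D >= c / 8 * ln x\<close>.\<close>
  define C1 where "C1 = exp (- (2 * C3 / \<kappa>)) * c * exp (-13) / 256000"
  have P0: "P0 \<ge> 1" "8 / \<kappa>\<^sup>2 \<le> real P0" by (auto simp: P0_def) linarith
  have \<eta>: "\<eta> > 0" "\<eta> \<le> 1" "\<eta> \<le> c * \<kappa> / 128" using c \<kappa> by (auto simp: \<eta>_def)
  have "(\<Sum>p\<in>primes_le (real P0). 1 / real p) \<ge> 0" by (intro sum_nonneg) auto
  moreover have "ln \<eta> \<le> 0" using \<eta> by simp
  ultimately have C3: "C3 \<ge> 1" unfolding C3_def by linarith
  have "eventually (\<lambda>x. x \<ge> 1 \<and> x powr (1 - c / 2) \<ge> 4000 \<and>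
          x powr (1 - c) * ln x \<le> x powr (1 - c / 2) / 8000 \<and> x powr (c / 8) \<ge> 2) at_top"
    using c by (intro eventually_conj; real_asymp)
  then obtain x0 where x0: "\<And>x. x \<ge> x0 \<Longrightarrow> x \<ge> 1 \<and> x powr (1 - c / 2) \<ge> 4000 \<and>
          x powr (1 - c) * ln x \<le> x powr (1 - c / 2) / 8000 \<and> x powr (c / 8) \<ge> 2"
    by (auto simp: eventually_at_top_linorder)
  have "eventually (\<lambda>y. ln (ln y) \<ge> 2 * C3 \<and> \<eta> * ln y \<ge> 4) at_top"
    using \<eta> by (intro eventually_conj; real_asymp)
  then obtain y1 where y1: "\<And>y. y \<ge> y1 \<Longrightarrow> ln (ln y) \<ge> 2 * C3 \<and> \<eta> * ln y \<ge> 4"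
    by (auto simp: eventually_at_top_linorder)

  have bound: "C1 * main_term k x y \<le> real (N_count k x y)"
    if "x > 0" "max x0 y1 \<le> y" "2 \<le> y" "y \<le> x powr (1 - c)" "1 \<le> k" "real k \<le> ln (ln y) / \<kappa>"
    for x y k
  proof -
    define L where "L = ln (ln y)"
    define z where "z = y powr \<eta>"
    define P where "P = primes_le z - primes_le (real P0)"
    define E where "E = (\<Sum>p\<in>P. 1 / real p)"
    \<comment> \<open>The small primes and the rough factor each receive a budget of
      \<open>D\<close>, so that their product stays within \<open>x powr (c / 2)\<close>.\<close>
    define D where "D = nat \<lfloor>x powr (c / 4)\<rfloor>"
    define Q where "Q = (\<Sum>T | T \<in> subsets_of_card P k \<and> real (\<Prod>T) \<le> real D. 1 / real (\<Prod>T))"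
    \<comment> \<open>This turns the threshold on \<open>y\<close> into one on
      \<open>x\<close>.\<close>
    have yx: "y \<le> x"
    proof (rule ccontr)
      assume "\<not> y \<le> x"
      hence "x powr (1 - c) < y"
      proof (cases "x \<ge> 1")
        case True
        hence "x powr (1 - c) \<le> x powr 1" using c by (intro powr_mono) auto
        thus ?thesis using \<open>\<not> y \<le> x\<close> True by simp
      next
        case False
        hence "x powr (1 - c) \<le> 1 powr (1 - c)" using c \<open>x > 0\<close> by (intro powr_mono2) auto
        thus ?thesis using \<open>2 \<le> y\<close> by simp
      qed
      thus False using that by simp
    qed
    have lny: "ln y > 0" using that by simp
    have L: "L \<ge> 2 * C3" "\<eta> * ln y \<ge> 4" using y1[of y] that by (auto simp: L_def)
    have x: "x \<ge> 1" "x powr (1 - c / 2) \<ge> 4000"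
        "x powr (1 - c) * ln x \<le> x powr (1 - c / 2) / 8000" "x powr (c / 8) \<ge> 2"
      using x0[of x] that yx by auto
    have lnx: "ln x > 0" "ln y \<le> ln x" using yx that by auto
    have kL: "real k * \<kappa> \<le> L" using that \<kappa> by (simp add: L_def pos_le_divide_eq)

    have lnz: "ln z = \<eta> * ln y" using that by (simp add: z_def ln_powr)
    have z: "z > 1" "z \<le> y"
    proof -
      show "z > 1" unfolding z_def using that \<eta> by (intro gr_one_powr) auto
      have "y powr \<eta> \<le> y powr 1" using that \<eta> by (intro powr_mono) auto
      thus "z \<le> y" using that by (simp add: z_def)
    qed
    have P: "finite P" "P \<subseteq> primes_le y" "P \<subseteq> primes_le z" "\<And>p. p \<in> P \<Longrightarrow> P0 < p"
    proof -
      show "finite P" by (simp add: P_def)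
    qed (use z in \<open>auto simp: P_def primes_le_def\<close>)
    have EL: "L \<le> E + C3"
    proof -
      have "ln (ln z) \<le> (\<Sum>p\<in>primes_le z. 1 / real p) + 1"
        using prime_weight_ge[of z] prime_weight_le_sum_inverse[of z] z by linarith
      also have "(\<Sum>p\<in>primes_le z. 1 / real p) \<le>
                   (\<Sum>p\<in>P \<union> primes_le (real P0). 1 / real p)"
        by (intro sum_mono2) (auto simp: P_def)
      also have "\<dots> = E + (\<Sum>p\<in>primes_le (real P0). 1 / real p)"
        unfolding E_def using P by (intro sum.union_disjoint) (auto simp: P_def)
      also have "ln (ln z) = ln \<eta> + L"
        unfolding lnz L_def using \<eta> lny by (intro ln_mult_pos) auto
      finally show ?thesis by (simp add: C3_def)
    qed
    hence E2: "E \<ge> L / 2" using L by linarith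
    hence Epos: "E > 0" using L C3 by linarith
    have "real k * \<kappa> \<le> 2 * E" using kL E2 by linarith
    hence kE: "real k \<le> E * (2 / \<kappa>)" using \<kappa> by (simp add: pos_le_divide_eq mult.commute)
    hence kE': "real k / E \<le> 2 / \<kappa>" using Epos by (simp add: pos_divide_le_eq mult.commute)

    have D: "real D \<ge> x powr (c / 8)" "real (D * D) \<le> x powr (c / 2)"
    proof -
      \<comment> \<open>Since \<open>u >= 2\<close>, rounding \<open>u * u\<close> down still leaves
        at least \<open>u\<close>.\<close>
      define u where "u = x powr (c / 8)"
      have u: "u \<ge> 2" using x by (simp add: u_def)
      have u2: "x powr (c / 4) = u * u" by (simp add: u_def flip: powr_add)
      have "real D > u * u - 1" unfolding D_def u2 by linarith
      moreover have "u * u \<ge> 2 * u" using u by (intro mult_right_mono) auto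
      ultimately show "real D \<ge> x powr (c / 8)" using u by (simp add: u_def)
      have "real D \<le> u * u" unfolding D_def u2 using u by (intro of_nat_floor) auto
      hence "real D * real D \<le> (u * u) * (u * u)" using u by (intro mult_mono) auto
      also have "\<dots> = x powr (c / 2)" by (simp flip: u2 powr_add)
      finally show "real (D * D) \<le> x powr (c / 2)" by simp
    qed
    have "ln (x powr (c / 8)) \<le> ln (real D)" using D x by (intro ln_mono) auto
    hence lnD: "c / 8 * ln x \<le> ln (real D)" using x by (simp add: ln_powr)
    have "0 < c / 8 * ln x" using c lnx by simp
    hence lnD_pos: "ln (real D) > 0" using lnD by linarith

    have "E ^ k / (4 * fact k) \<le> Q"
      unfolding Q_def E_def
    proof (rule truncated_elem_sym_ge)
      show "finite P" "1 \<le> k" by fact+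
      show "1 \<le> p" if "p \<in> P" for p using P(4)[OF that] by simp
      show "1 < real D" using D x by linarith
      show "0 < (\<Sum>p\<in>P. 1 / real p)" using Epos by (simp add: E_def)
      have "(\<Sum>p\<in>P. (1 / real p)\<^sup>2) \<le> 1 / real P0"
        using P P0 by (intro sum_inverse_squares_le) auto
      also have "\<dots> \<le> \<kappa>\<^sup>2 / 8" using P0 \<kappa> by (simp add: field_simps)
      finally have "(\<Sum>p\<in>P. (1 / real p)\<^sup>2) * (real k / E)\<^sup>2 \<le> \<kappa>\<^sup>2 / 8 * (2 / \<kappa>)\<^sup>2"
        using kE' Epos by (intro mult_mono power_mono) auto
      thus "(\<Sum>p\<in>P. (1 / real p)\<^sup>2) * (real k)\<^sup>2 / (\<Sum>p\<in>P. 1 / real p)\<^sup>2 \<le> 1 / 2"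
        using \<kappa> by (simp add: E_def power_divide)
      have "(\<Sum>p\<in>P. ln (real p) / real p) \<le> (\<Sum>p\<in>primes_le z. ln (real p) / real p)"
        using P by (intro sum_mono2 finite_primes_le) (auto simp: primes_le_def prime_gt_0_nat Suc_le_eq)
      also have "\<dots> \<le> ln z + 4" using z by (intro sum_ln_prime_div_le) auto
      also have "\<dots> \<le> 2 * (\<eta> * ln y)" using L lnz by simp
      also have "\<dots> \<le> 2 * (c * \<kappa> / 128 * ln x)"
        using \<eta> lnx lny by (intro mult_left_mono mult_mono) auto
      also have "\<dots> = \<kappa> / 8 * (c / 8 * ln x)" by simp
      also have "\<dots> \<le> \<kappa> / 8 * ln (real D)" using lnD \<kappa> by (intro mult_left_mono) auto
      finally have "(\<Sum>p\<in>P. ln (real p) / real p) / ln (real D) * (real k / E) \<le> \<kappa> / 8 * (2 / \<kappa>)"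
        using kE' Epos lnD_pos \<kappa> by (intro mult_mono) (auto simp: pos_divide_le_eq)
      thus "(\<Sum>p\<in>P. ln (real p) / real p) * real k / ((\<Sum>p\<in>P. 1 / real p) * ln (real D)) \<le> 1 / 4"
        using \<kappa> by (simp add: E_def mult.commute)
    qed
    moreover have "exp (- (2 * C3 / \<kappa>)) * L ^ k \<le> E ^ k"
    proof -
      \<comment> \<open>The deficit is again traded for a constant factor, now in the lower bound
        direction.\<close>
      have "L ^ k \<le> (E + C3) ^ k" using EL L C3 by (intro power_mono) auto
      also have "\<dots> \<le> exp (C3 * (2 / \<kappa>)) * E ^ k"
        using Epos C3 kE by (intro power_add_le_exp) auto
      finally have "exp (- (2 * C3 / \<kappa>)) * L ^ k \<le>
          exp (- (2 * C3 / \<kappa>)) * (exp (C3 * (2 / \<kappa>)) * E ^ k)"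
        by (intro mult_left_mono) auto
      also have "\<dots> = (exp (- (2 * C3 / \<kappa>)) * exp (C3 * (2 / \<kappa>))) * E ^ k" by simp
      also have "exp (- (2 * C3 / \<kappa>)) * exp (C3 * (2 / \<kappa>)) = 1"
        by (simp flip: exp_add)
      finally show ?thesis by simp
    qed
    hence "exp (- (2 * C3 / \<kappa>)) * L ^ k / (4 * fact k) \<le> E ^ k / (4 * fact k)"
      by (intro divide_right_mono) auto
    ultimately have Q: "exp (- (2 * C3 / \<kappa>)) * L ^ k / (4 * fact k) \<le> Q" by linarith

    have S0: "c / 8 * ln x * exp (-13) / ln y \<le> recip_sum {1..D} y 0"
    proof -
      have "ln (real D) \<le> ln (real D + 1)" using D x by (intro ln_mono) auto
      hence "c / 8 * ln x \<le> ln (real D + 1)" using lnD by linarith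
      also have "\<dots> \<le> exp (prime_weight y) * recip_sum {1..D} y 0" by (rule rough_sum_ge)
      also have "\<dots> \<le> exp (L + 13) * recip_sum {1..D} y 0"
        using prime_weight_le[of y] that
        by (intro mult_right_mono recip_sum_nonneg) (auto simp: L_def)
      \<comment> \<open>As \<open>exp L = ln y\<close>, the rough sum up to \<open>D\<close> is at
        least a constant times \<open>ln x / ln y\<close>.\<close>
      also have "exp (L + 13) = ln y * exp 13"
        using lny by (simp add: L_def exp_add)
      finally have "c / 8 * ln x * exp (-13) / ln y \<le>
          (ln y * exp 13 * recip_sum {1..D} y 0) * exp (-13) / ln y"
        using lny by (intro divide_right_mono mult_right_mono) auto
      also have "\<dots> = recip_sum {1..D} y 0 * (exp 13 * exp (-13))" using lny by simp
      also have "exp 13 * exp (-13 :: real) = 1" by (simp flip: exp_add)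
      finally show ?thesis by simp
    qed

    have "C1 * main_term k x y * ln x = x / 8000 *
        ((exp (- (2 * C3 / \<kappa>)) * L ^ k / (4 * fact k)) * (c / 8 * ln x * exp (-13) / ln y))"
      by (simp add: C1_def main_term_def L_def)
    also have "\<dots> \<le> x / 8000 * (Q * recip_sum {1..D} y 0)"
      using x Q S0 c lny lnx L C3 by (intro mult_left_mono mult_mono) (auto intro: order.trans[rotated])
    also have "\<dots> \<le> x / 8000 * recip_sum {1..D * D} y k"
      using x recip_sum_ge[OF P(2), of k D] by (intro mult_left_mono) (auto simp: Q_def)
    also have "\<dots> \<le> real (N_count k x y) * ln x"
      using c x that D by (intro N_count_ge_recip_sum[of c]) auto
    finally show ?thesis using lnx by simp
  qed
  have "C1 > 0" using c by (simp add: C1_def)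
  show ?thesis
    by (rule exI[of _ C1], rule exI[of _ "max x0 y1"]) (use \<open>C1 > 0\<close> bound in blast)
qed

theorem theorem1p4:
  fixes c \<kappa> :: real
  assumes "0 < c" and "c < 1" and "0 < \<kappa>"
  shows "\<exists>C1 C2 y0 :: real. 0 < C1 \<and> 0 < C2 \<and>
    (\<forall>(x::real) (y::real) (k::nat).
       0 < x \<and> 2 \<le> y \<and> y \<le> x powr (1 - c) \<and> 1 \<le> k \<and> real k \<le> ln (ln y) / \<kappa> \<longrightarrow>
         real (N_count k x y) \<le> C2 * main_term k x y \<and>
         (y0 \<le> y \<or> N_count k x y \<noteq> 0 \<longrightarrow>
            C1 * main_term k x y \<le> real (N_count k x y)))"
proof -
  obtain C y0 where C: "C > 0" and lower: "\<And>x y k. x > 0 \<Longrightarrow> y0 \<le> y \<Longrightarrow> 2 \<le> y \<Longrightarrow>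
      y \<le> x powr (1 - c) \<Longrightarrow> 1 \<le> k \<Longrightarrow> real k \<le> ln (ln y) / \<kappa> \<Longrightarrow>
      C * main_term k x y \<le> real (N_count k x y)"
    using N_count_lower_bound[OF assms] by blast
  \<comment> \<open>For \<open>y < y0\<close> the product of the primes up to \<open>y\<close>
    divides this one, so a single constant covers all such \<open>y\<close>; there
    \<open>main_term\<close> is simply bounded by \<open>x\<close>.\<close>
  define Q where "Q = real (\<Prod>(primes_le y0))"
  define C1 where "C1 = min C (1 / (Q * (Q + 1)))"
  define C2 where "C2 = 20 * exp (13 / \<kappa>) * (1 + 1 / \<kappa>)"
  have prod_pos: "\<Prod>(primes_le t) > 0" for t
    by (intro prod_pos) (auto simp: primes_le_def prime_gt_0_nat)
  hence Q: "Q > 0" unfolding Q_def by (simp only: of_nat_0_less_iff)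
  have pos: "C1 > 0" "C2 > 0" using C Q assms by (simp_all add: C1_def C2_def add_pos_pos)
  have bounds: "real (N_count k x y) \<le> C2 * main_term k x y \<and>
      (y0 \<le> y \<or> N_count k x y \<noteq> 0 \<longrightarrow> C1 * main_term k x y \<le> real (N_count k x y))"
    if H: "0 < x" "2 \<le> y" "y \<le> x powr (1 - c)" "1 \<le> k" "real k \<le> ln (ln y) / \<kappa>" for x y k
  proof -
    have "real k > 0" using H by simp
    hence "ln (ln y) / \<kappa> > 0" using H by linarith
    hence L: "ln (ln y) > 0" using assms by (simp add: zero_less_divide_iff)
    have lny: "ln y > 0" using H by simp
    have main_nonneg: "main_term k x y \<ge> 0" using H L lny by (simp add: main_term_def)
    have "x \<ge> 1"
    proof (rule ccontr)
      assume "\<not> x \<ge> 1"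
      hence "x powr (1 - c) \<le> 1 powr (1 - c)" using H assms by (intro powr_mono2) auto
      thus False using H by simp
    qed
    hence "x powr (1 - c) \<le> x powr 1" using assms by (intro powr_mono) auto
    hence "y \<le> x" using H by simp
    hence "real (N_count k x y) \<le> C2 * main_term k x y"
      unfolding C2_def using H assms by (intro N_count_upper_bound) auto
    moreover have "C1 * main_term k x y \<le> real (N_count k x y)" if "y0 \<le> y \<or> N_count k x y \<noteq> 0"
    proof (cases "y0 \<le> y")
      case True
      have "C1 * main_term k x y \<le> C * main_term k x y"
        using main_nonneg by (intro mult_right_mono) (auto simp: C1_def)
      also have "\<dots> \<le> real (N_count k x y)" using H True by (intro lower)
      finally show ?thesis .
    next
      case False
      define q where "q = real (\<Prod>(primes_le y))"
      have "\<Prod>(primes_le y) dvd \<Prod>(primes_le y0)"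
        using False by (intro prod_dvd_prod_subset finite_primes_le) (auto simp: primes_le_def)
      hence "\<Prod>(primes_le y) \<le> \<Prod>(primes_le y0)" using prod_pos by (rule dvd_imp_le)
      hence q: "0 \<le> q" "q \<le> Q" unfolding q_def Q_def by (simp_all only: of_nat_le_iff of_nat_0_le_iff)
      have "x \<le> q * (q + 1) * real (N_count k x y)"
        unfolding q_def using False that H by (intro N_count_ge_proportion) auto
      also have "\<dots> \<le> Q * (Q + 1) * real (N_count k x y)"
        using q by (intro mult_right_mono mult_mono) auto
      finally have "x / (Q * (Q + 1)) \<le> real (N_count k x y)"
        using Q by (simp add: pos_divide_le_eq mult.commute)
      moreover have "C1 * main_term k x y \<le> 1 / (Q * (Q + 1)) * x"
        using main_nonneg main_term_le[of x y k] H L lny Q by (intro mult_mono) (auto simp: C1_def)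
      ultimately show ?thesis by simp
    qed
    ultimately show ?thesis by blast
  qed
  show ?thesis
    by (rule exI[of _ C1], rule exI[of _ C2], rule exI[of _ y0]) (use pos bounds in blast)
qed

end
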